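(* A design $\xi_{eE}^*\in\Xi$ is optimal for $\phi_{eE}(\cdot)$ (that is, it maximizes $\phi_{eE}(\xi)$ with respect to $\xi\in\Xi$) if and only if $$\max_{x\in\mathscr{X}}\int_{\Theta_E(\xi_{eE}^* )}\Psi_{eE}(x,\theta,\xi_{eE}^* )\,\mu^*(d\theta)=0\quad\text{for some measure }\mu^*\in\mathscr{M}[\Theta_E(\xi_{eE}^* )],$$ where $\mathscr{M}[\Theta_E(\xi_{eE}^* )]$ is the set of probability measures on $\Theta_E(\xi_{eE}^* )$.
   Context: Setting: a nonlinear regression model with response $\eta(x,\theta)$, where the parameter $\theta$ belongs to $\Theta$, a compact subset of $\mathbb{R}^p$ such that $\Theta\subset\overline{\mathrm{int}(\Theta)}$ (the closure of the interior of $\Theta$), and $x$ belongs to the design space $\mathscr{X}$, a compact subset of $\mathbb{R}^d$. The response $\eta(x,\theta)$ is twice continuously differentiable with respect to $\theta\in\mathrm{int}(\Theta)$ for any $x\in\mathscr{X}$, and the model is identifiable over $\mathscr{X}$: $\eta(x,\theta')=\eta(x,\theta)$ for all $x\in\mathscr{X}$ implies $\theta'=\theta$. $\Xi$ denotes the set of design measures, that is, of probability measures on $\mathscr{X}$. A point $\theta^0\in\Theta$ is fixed. Definitions. For $\xi\in\Xi$ and $\theta\in\Theta$, $$H_E(\xi,\theta)=\frac{\|\eta(\cdot,\theta)-\eta(\cdot,\theta^0)\|_\xi^2}{\|\theta-\theta^0\|^2},\qquad \|l\|_\xi=\left[\int_{\mathscr{X}}l^2(x)\,\xi(dx)\right]^{1/2}\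 \text{ for } l\in\mathscr{L}_2(\xi).$$ The extended $E$-optimality criterion is $$\phi_{eE}(\xi)=\min_{\theta\in\Theta}H_E(\xi,\theta),$$ to be maximized with respect to the design measure $\xi$. Moreover, $$\Theta_E(\xi)=\{\theta\in\Theta:\ H_E(\xi,\theta)=\phi_{eE}(\xi)\},$$ $$\Psi_{eE}(x,\theta,\xi)=\frac{[\eta(x,\theta)-\eta(x,\theta^0)]^2-\|\eta(\cdot,\theta)-\eta(\cdot,\theta^0)\|_\xi^2}{\|\theta-\theta^0\|^2}.$$
   Formalization: As H_E and Ψ are 0/0 at θ⁰, θ⁰ is replaced in Θ by its limiting unit directions with derivative values. Assumed: η(x,·) continuous on Θ and differentiable at θ⁰ within Θ; η(·,θ)−η(·,θ⁰) and directional derivatives at θ⁰ in L₂(ν) for every design ν. *)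

theory Defs
  imports "HOL-Probability.Probability"
begin

definition prob_measures :: "'a::topological_space set \<Rightarrow> 'a measure set" where
  "prob_measures S = {\<mu>. prob_space \<mu> \<and> sets \<mu> = sets (restrict_space borel S)}"

definition L2_space :: "'a measure \<Rightarrow> ('a \<Rightarrow> real) set" where
  "L2_space \<xi> = {l \<in> borel_measurable \<xi>. integrable \<xi> (\<lambda>x. (l x)\<^sup>2)}"

definition L2_norm :: "'a measure \<Rightarrow> ('a \<Rightarrow> real) \<Rightarrow> real" where
  "L2_norm \<xi> l = sqrt (\<integral>x. (l x)\<^sup>2 \<partial>\<xi>)"

definition twice_continuously_differentiable_on ::
    "('a::real_normed_vector \<Rightarrow> real) \<Rightarrow> 'a set \<Rightarrow> bool" where
  "twice_continuously_differentiable_on f S \<longleftrightarrow>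
    (\<exists>(f' :: 'a \<Rightarrow> 'a \<Rightarrow>\<^sub>L real) (f'' :: 'a \<Rightarrow> 'a \<Rightarrow>\<^sub>L 'a \<Rightarrow>\<^sub>L real).
      (\<forall>\<theta>\<in>S. (f has_derivative blinfun_apply (f' \<theta>)) (at \<theta>)) \<and>
      (\<forall>\<theta>\<in>S. (f' has_derivative blinfun_apply (f'' \<theta>)) (at \<theta>)) \<and>
      continuous_on S f'')"

text \<open>
  The quotient \<open>H\<^sub>E(\<xi>,\<theta>)\<close> is of the form 0/0 at \<open>\<theta> = \<theta>0\<close>, and its limit there depends on the
  direction of approach. The minimisation over \<open>\<Theta>\<close> therefore keeps track of that direction:
  a point \<open>\<theta> \<noteq> \<theta>0\<close> of \<open>\<Theta>\<close> is represented by the single pair \<open>(\<theta>, sgn (\<theta> - \<theta>0))\<close>,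
  and the point \<open>\<theta>0\<close> by the pairs \<open>(\<theta>0, u)\<close>, where \<open>u\<close> is any limit of unit vectors
  \<open>sgn (\<theta>\<^sub>n - \<theta>0)\<close> with \<open>\<theta>\<^sub>n \<in> \<Theta> - {\<theta>0}\<close> and \<open>\<theta>\<^sub>n \<longlonglongrightarrow> \<theta>0\<close>
  (all unit vectors if \<open>\<theta>0\<close> is interior).
\<close>

definition directed_points ::
    "'p::real_normed_vector set \<Rightarrow> 'p \<Rightarrow> ('p \<times> 'p) set" where
  "directed_points \<Theta> \<theta>0 = closure ((\<lambda>\<theta>. (\<theta>, sgn (\<theta> - \<theta>0))) ` (\<Theta> - {\<theta>0}))"

text \<open>
  The limit of \<open>(\<eta> x \<theta> - \<eta> x \<theta>0) / norm (\<theta> - \<theta>0)\<close> as \<open>\<theta> \<rightarrow> \<theta>0\<close> within \<open>\<Theta>\<close> in the direction \<open>u\<close>.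
  If \<open>(\<theta>0, u) \<in> directed_points \<Theta> \<theta>0\<close>, it does not depend on which derivative within \<open>\<Theta>\<close>
  is selected.
\<close>

definition directional_response ::
    "('x \<Rightarrow> 'p::real_normed_vector \<Rightarrow> real) \<Rightarrow> 'p set \<Rightarrow> 'p \<Rightarrow> 'p \<Rightarrow> 'x \<Rightarrow> real" where
  "directional_response \<eta> \<Theta> \<theta>0 u x = frechet_derivative (\<eta> x) (at \<theta>0 within \<Theta>) u"

definition H_E ::
    "('x \<Rightarrow> 'p::real_normed_vector \<Rightarrow> real) \<Rightarrow> 'p set \<Rightarrow> 'p \<Rightarrow> 'x measure \<Rightarrow> 'p \<times> 'p \<Rightarrow> real" where
  "H_E \<eta> \<Theta> \<theta>0 \<xi> = (\<lambda>(\<theta>, u).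
     if \<theta> \<noteq> \<theta>0 then (L2_norm \<xi> (\<lambda>x. \<eta> x \<theta> - \<eta> x \<theta>0))\<^sup>2 / (norm (\<theta> - \<theta>0))\<^sup>2
     else (L2_norm \<xi> (directional_response \<eta> \<Theta> \<theta>0 u))\<^sup>2)"

definition phi_eE ::
    "('x \<Rightarrow> 'p::real_normed_vector \<Rightarrow> real) \<Rightarrow> 'p set \<Rightarrow> 'p \<Rightarrow> 'x measure \<Rightarrow> real" where
  "phi_eE \<eta> \<Theta> \<theta>0 \<xi> = (INF \<omega> \<in> directed_points \<Theta> \<theta>0. H_E \<eta> \<Theta> \<theta>0 \<xi> \<omega>)"

definition Theta_E ::
    "('x \<Rightarrow> 'p::real_normed_vector \<Rightarrow> real) \<Rightarrow> 'p set \<Rightarrow> 'p \<Rightarrow> 'x measure \<Rightarrow> ('p \<times> 'p) set" where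
  "Theta_E \<eta> \<Theta> \<theta>0 \<xi> =
     {\<omega> \<in> directed_points \<Theta> \<theta>0. H_E \<eta> \<Theta> \<theta>0 \<xi> \<omega> = phi_eE \<eta> \<Theta> \<theta>0 \<xi>}"

definition Psi_eE ::
    "('x \<Rightarrow> 'p::real_normed_vector \<Rightarrow> real) \<Rightarrow> 'p set \<Rightarrow> 'p \<Rightarrow> 'x \<Rightarrow> 'p \<times> 'p \<Rightarrow> 'x measure \<Rightarrow> real"
  where
  "Psi_eE \<eta> \<Theta> \<theta>0 x = (\<lambda>(\<theta>, u) \<xi>.
     if \<theta> \<noteq> \<theta>0 then
       ((\<eta> x \<theta> - \<eta> x \<theta>0)\<^sup>2 - (L2_norm \<xi> (\<lambda>x. \<eta> x \<theta> - \<eta> x \<theta>0))\<^sup>2) / (norm (\<theta> - \<theta>0))\<^sup>2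
     else
       (directional_response \<eta> \<Theta> \<theta>0 u x)\<^sup>2 - (L2_norm \<xi> (directional_response \<eta> \<Theta> \<theta>0 u))\<^sup>2)"

definition optimal_design ::
    "('x::topological_space \<Rightarrow> 'p::real_normed_vector \<Rightarrow> real) \<Rightarrow> 'x set \<Rightarrow> 'p set \<Rightarrow> 'p \<Rightarrow>
      'x measure \<Rightarrow> bool" where
  "optimal_design \<eta> X \<Theta> \<theta>0 \<xi> \<longleftrightarrow>
     \<xi> \<in> prob_measures X \<and>
     (\<forall>\<nu> \<in> prob_measures X. phi_eE \<eta> \<Theta> \<theta>0 \<nu> \<le> phi_eE \<eta> \<Theta> \<theta>0 \<xi>)"

lemma directed_points_off_center:
  assumes "closed \<Theta>" "\<theta> \<noteq> \<theta>0"
  shows "(\<theta>, u) \<in> directed_points \<Theta> \<theta>0 \<longleftrightarrow> \<theta> \<in> \<Theta> \<and> u = sgn (\<theta> - \<theta>0)"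
proof
  assume "(\<theta>, u) \<in> directed_points \<Theta> \<theta>0"
  then obtain w where w: "\<And>n. w n \<in> (\<lambda>\<theta>. (\<theta>, sgn (\<theta> - \<theta>0))) ` (\<Theta> - {\<theta>0})" "w \<longlonglongrightarrow> (\<theta>, u)"
    unfolding directed_points_def closure_sequential by blast
  define t where "t n = fst (w n)" for n
  have t: "t n \<in> \<Theta>" "w n = (t n, sgn (t n - \<theta>0))" for n
    using w(1)[of n] by (auto simp: t_def)
  have lim_t: "t \<longlonglongrightarrow> \<theta>"
    using tendsto_fst[OF w(2)] by (simp add: t_def[abs_def])
  have "(\<lambda>n. sgn (t n - \<theta>0)) \<longlonglongrightarrow> u"
    using tendsto_snd[OF w(2)] by (simp add: t(2))
  moreover have "(\<lambda>n. sgn (t n - \<theta>0)) \<longlonglongrightarrow> sgn (\<theta> - \<theta>0)"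
    by (intro tendsto_intros lim_t) (use assms in auto)
  ultimately show "\<theta> \<in> \<Theta> \<and> u = sgn (\<theta> - \<theta>0)"
    using LIMSEQ_unique closed_sequentially[OF assms(1) t(1) lim_t] by blast
next
  assume "\<theta> \<in> \<Theta> \<and> u = sgn (\<theta> - \<theta>0)"
  then show "(\<theta>, u) \<in> directed_points \<Theta> \<theta>0"
    using assms(2) closure_subset unfolding directed_points_def by fastforce
qed

text \<open>
  If the difference quotients are uniformly bounded, the criterion is the infimum of the
  quotient over \<open>\<Theta> - {\<theta>0}\<close>, so that the values at \<open>\<theta>0\<close> do not alter it.
\<close>

lemma phi_eE_eq_INF_off_center:
  fixes \<eta> :: "'x \<Rightarrow> 'p::real_normed_vector \<Rightarrow> real"
  assumes "closed \<Theta>" and ne: "\<Theta> - {\<theta>0} \<noteq> {}" and \<xi>: "prob_space \<xi>"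
    and meas: "\<And>\<theta>. \<theta> \<in> \<Theta> \<Longrightarrow> (\<lambda>x. \<eta> x \<theta> - \<eta> x \<theta>0) \<in> borel_measurable \<xi>"
    and diff: "\<And>x. x \<in> space \<xi> \<Longrightarrow> \<eta> x differentiable (at \<theta>0 within \<Theta>)"
    and bound: "\<And>x \<theta>. x \<in> space \<xi> \<Longrightarrow> \<theta> \<in> \<Theta> \<Longrightarrow> \<bar>\<eta> x \<theta> - \<eta> x \<theta>0\<bar> \<le> L * norm (\<theta> - \<theta>0)"
  shows "phi_eE \<eta> \<Theta> \<theta>0 \<xi> =
    (INF \<theta> \<in> \<Theta> - {\<theta>0}. (L2_norm \<xi> (\<lambda>x. \<eta> x \<theta> - \<eta> x \<theta>0))\<^sup>2 / (norm (\<theta> - \<theta>0))\<^sup>2)"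
    (is "_ = (INF \<theta> \<in> _. ?h \<theta>)")
proof (rule antisym)
  interpret prob_space \<xi> by fact
  have bdd: "bdd_below (range (H_E \<eta> \<Theta> \<theta>0 \<xi>))"
    by (rule bdd_belowI[of _ 0]) (auto simp: H_E_def split: if_splits)
  have bdd': "bdd_below (?h ` (\<Theta> - {\<theta>0}))"
    by (rule bdd_belowI[of _ 0]) auto
  show "phi_eE \<eta> \<Theta> \<theta>0 \<xi> \<le> (INF \<theta> \<in> \<Theta> - {\<theta>0}. ?h \<theta>)"
  proof (rule cINF_greatest[OF ne])
    fix \<theta> assume "\<theta> \<in> \<Theta> - {\<theta>0}"
    then have "(\<theta>, sgn (\<theta> - \<theta>0)) \<in> directed_points \<Theta> \<theta>0"
      using directed_points_off_center assms(1) by blast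
    then have "phi_eE \<eta> \<Theta> \<theta>0 \<xi> \<le> H_E \<eta> \<Theta> \<theta>0 \<xi> (\<theta>, sgn (\<theta> - \<theta>0))"
      unfolding phi_eE_def by (intro cINF_lower bdd_below_mono[OF bdd]) auto
    then show "phi_eE \<eta> \<Theta> \<theta>0 \<xi> \<le> ?h \<theta>"
      using \<open>\<theta> \<in> \<Theta> - {\<theta>0}\<close> by (simp add: H_E_def)
  qed
  have dne: "directed_points \<Theta> \<theta>0 \<noteq> {}"
    using ne by (auto simp: directed_points_def)
  show "(INF \<theta> \<in> \<Theta> - {\<theta>0}. ?h \<theta>) \<le> phi_eE \<eta> \<Theta> \<theta>0 \<xi>"
    unfolding phi_eE_def
  proof (rule cINF_greatest[OF dne], clarify)
    fix \<theta> u assume in_dp: "(\<theta>, u) \<in> directed_points \<Theta> \<theta>0"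
    show "(INF \<theta> \<in> \<Theta> - {\<theta>0}. ?h \<theta>) \<le> H_E \<eta> \<Theta> \<theta>0 \<xi> (\<theta>, u)"
    proof (cases "\<theta> = \<theta>0")
      case False
      then have "\<theta> \<in> \<Theta> - {\<theta>0}"
        using in_dp directed_points_off_center assms(1) by blast
      then show ?thesis
        using cINF_lower[OF bdd'] False by (simp add: H_E_def)
    next
      case True
      obtain w where w: "\<And>n. w n \<in> (\<lambda>\<theta>. (\<theta>, sgn (\<theta> - \<theta>0))) ` (\<Theta> - {\<theta>0})"
          "w \<longlonglongrightarrow> (\<theta>, u)"
        using in_dp unfolding directed_points_def closure_sequential by blast
      define t where "t n = fst (w n)" for n
      have t: "t n \<in> \<Theta> - {\<theta>0}" "w n = (t n, sgn (t n - \<theta>0))" for n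
      proof -
        obtain s where "s \<in> \<Theta> - {\<theta>0}" "w n = (s, sgn (s - \<theta>0))"
          using w(1)[of n] by blast
        then show "t n \<in> \<Theta> - {\<theta>0}" "w n = (t n, sgn (t n - \<theta>0))"
          by (simp_all add: t_def)
      qed
      have lim_t: "t \<longlonglongrightarrow> \<theta>0"
        using tendsto_fst[OF w(2)] True by (simp add: t_def[abs_def])
      have lim_u: "(\<lambda>n. sgn (t n - \<theta>0)) \<longlonglongrightarrow> u"
        using tendsto_snd[OF w(2)] by (simp add: t(2))
      define q where "q n x = (\<eta> x (t n) - \<eta> x \<theta>0) / norm (t n - \<theta>0)" for n x
      let ?d = "directional_response \<eta> \<Theta> \<theta>0 u"
      have lim_q: "(\<lambda>n. q n x) \<longlonglongrightarrow> ?d x" if x: "x \<in> space \<xi>" for x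
      proof -
        define D where "D = frechet_derivative (\<eta> x) (at \<theta>0 within \<Theta>)"
        have D: "(\<eta> x has_derivative D) (at \<theta>0 within \<Theta>)"
          using diff[OF x] by (simp add: D_def frechet_derivative_works)
        interpret D: bounded_linear D
          using D by (rule has_derivative_bounded_linear)
        have "filterlim t (at \<theta>0 within \<Theta>) sequentially"
          using lim_t t(1) by (auto simp: filterlim_at)
        moreover have "((\<lambda>y. (\<eta> x y - \<eta> x \<theta>0 - D (y - \<theta>0)) /\<^sub>R norm (y - \<theta>0)) \<longlongrightarrow> 0)
            (at \<theta>0 within \<Theta>)"
          using D by (simp add: has_derivative_at_within)
        ultimately have "(\<lambda>n. (\<eta> x (t n) - \<eta> x \<theta>0 - D (t n - \<theta>0)) /\<^sub>R norm (t n - \<theta>0)) \<longlonglongrightarrow> 0"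
          by (rule filterlim_compose[rotated])
        moreover have "(\<lambda>n. D (sgn (t n - \<theta>0))) \<longlonglongrightarrow> D u"
          by (rule D.tendsto[OF lim_u])
        ultimately have "(\<lambda>n. (\<eta> x (t n) - \<eta> x \<theta>0 - D (t n - \<theta>0)) /\<^sub>R norm (t n - \<theta>0)
            + D (sgn (t n - \<theta>0))) \<longlonglongrightarrow> 0 + D u"
          by (rule tendsto_add)
        moreover have "(\<eta> x (t n) - \<eta> x \<theta>0 - D (t n - \<theta>0)) /\<^sub>R norm (t n - \<theta>0)
            + D (sgn (t n - \<theta>0)) = q n x" for n
        proof -
          have "D (sgn (t n - \<theta>0)) = D (t n - \<theta>0) / norm (t n - \<theta>0)"
            by (simp only: sgn_div_norm D.scaleR real_scaleR_def divide_inverse mult.commute)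
          then show ?thesis
            by (simp add: q_def divide_inverse algebra_simps)
        qed
        ultimately show ?thesis
          by (simp add: D_def[symmetric] directional_response_def)
      qed
      have q_meas: "q n \<in> borel_measurable \<xi>" for n
        using meas[of "t n"] t(1) unfolding q_def by auto
      have d_meas: "?d \<in> borel_measurable \<xi>"
        by (rule borel_measurable_LIMSEQ_real[OF lim_q q_meas])
      have q_bound: "(q n x)\<^sup>2 \<le> L\<^sup>2" if "x \<in> space \<xi>" for n x
      proof -
        have "\<bar>q n x\<bar> \<le> L"
          using bound[OF that, of "t n"] t(1)[of n] by (simp add: q_def divide_le_eq)
        then show ?thesis
          by (metis abs_ge_zero power2_abs power_mono)
      qed
      have "(\<lambda>n. \<integral>x. (q n x)\<^sup>2 \<partial>\<xi>) \<longlonglongrightarrow> (\<integral>x. (?d x)\<^sup>2 \<partial>\<xi>)"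
      proof (rule integral_dominated_convergence[where w = "\<lambda>_. L\<^sup>2"])
        show "AE x in \<xi>. (\<lambda>n. (q n x)\<^sup>2) \<longlonglongrightarrow> (?d x)\<^sup>2"
          using lim_q by (intro AE_I2 tendsto_power)
      qed (use q_meas d_meas q_bound in auto)
      moreover have "(\<integral>x. (q n x)\<^sup>2 \<partial>\<xi>) = ?h (t n)" for n
        by (simp add: q_def L2_norm_def power_divide)
      moreover have "(\<integral>x. (?d x)\<^sup>2 \<partial>\<xi>) = H_E \<eta> \<Theta> \<theta>0 \<xi> (\<theta>, u)"
        using True by (simp add: H_E_def L2_norm_def)
      ultimately have "(\<lambda>n. ?h (t n)) \<longlonglongrightarrow> H_E \<eta> \<Theta> \<theta>0 \<xi> (\<theta>, u)"
        by simp
      then show ?thesis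
        by (rule LIMSEQ_le_const) (use cINF_lower[OF bdd'] t(1) in blast)
    qed
  qed
qed

end

theory Submission
  imports Defs
begin

text \<open>
  Let \<open>f x \<omega>\<close> be the squared response quotient at \<open>x\<close>, taken at the directed point
  \<open>\<omega> = (\<theta>, u)\<close>. Then \<open>H\<^sub>E(\<xi>, \<omega>)\<close> is the mean of \<open>f x \<omega>\<close> under \<open>\<xi>\<close>, so that maximising the criterion is
  the game in which the designer picks \<open>\<xi>\<close>, nature picks \<open>\<omega>\<close>, and the designer receives the mean
  of \<open>f\<close>. The condition on \<open>\<Psi>\<close> says that some mixed strategy \<open>\<mu>\<close> of nature, carried by
  the best replies to \<open>\<xi>\<close>, holds the designer down to \<open>c = \<phi>(\<xi>)\<close> at every \<open>x\<close>. The theorem is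
  therefore a minimax theorem together with complementary slackness.

  Sufficiency is weak duality: integrating \<open>\<integral> f x \<omega> d\<mu> \<le> c\<close> against any design \<open>\<nu>\<close> and exchanging
  the integrals gives \<open>\<phi>(\<nu>) \<le> c\<close> (\<open>dual_bound_imp_worst_case_le\<close>).

  For necessity, the difficulty is that \<open>f\<close> is only Borel in \<open>x\<close>, and bounded in \<open>x\<close> only for each
  \<open>\<omega>\<close> separately, so that the designs offer no compactness. But adding the directions at
  \<open>\<theta>0\<close> makes \<open>f x\<close> continuous on a compact set \<open>K\<close> of directed points
  (\<open>response_quotient_continuous\<close>), and this suffices on nature's side. For finitely many
  points \<open>x\<close>, separation of convex sets gives a finitely supported \<open>\<mu>\<close> that meets the constraints
  up to an error (\<open>finite_minimax\<close>): otherwise the weights of the separating functional would form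
  a finitely supported design better than \<open>\<xi>\<close>. Countably many \<open>x\<close> represent all of them, as \<open>C(K)\<close>
  is separable (\<open>countable_uniformly_dense_subfamily\<close>), so a weakly convergent sequence of such
  measures has a limit that meets all the constraints (\<open>dual_measure_exists\<close>). Weak sequential
  compactness is Helly's selection theorem on the real line, transported to \<open>K\<close> along a
  space-filling curve (\<open>pmf_on_compact_weakly_convergent_subseq\<close>).

  Finally, the mean of \<open>f\<close> under \<open>\<mu> \<otimes> \<xi>\<close> is at most \<open>c\<close> by the constraints and at least \<open>c\<close> because
  \<open>c\<close> is the infimum of \<open>H\<^sub>E(\<xi>, -)\<close>. Both bounds are thus attained almost everywhere
  (\<open>dual_measure_complementary_slackness\<close>), which puts \<open>\<mu>\<close> on \<open>\<Theta>\<^sub>E(\<xi>)\<close> and yields an \<open>x\<close> with equality.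
\<close>

section \<open>Minimax for finitely many constraints\<close>

text \<open>
  A finite form of the minimax theorem of Ky Fan: \<open>C\<close> is an abstract set on which every \<open>h i\<close> behaves
  as an affine function on a convex set. The induction removes one constraint \<open>k\<close> at a time.
  On the points of \<open>C\<close> that satisfy constraint \<open>k\<close>, the remaining constraints are merged into one weighted
  sum \<open>G\<close>; what is left is a problem with the two functions \<open>G\<close> and \<open>h k\<close>, settled by separating two
  convex sets in the plane. The slack \<open>e\<close> is halved at each step; it stands in for the attainment of a minimum on \<open>C\<close>.
\<close>

lemma finite_minimax:
  fixes h :: "'i \<Rightarrow> 'c \<Rightarrow> real"
  assumes "finite S" and "C \<noteq> {}"
    and "\<And>p q t. p \<in> C \<Longrightarrow> q \<in> C \<Longrightarrow> 0 \<le> t \<Longrightarrow> t \<le> 1 \<Longrightarrow>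
           \<exists>r\<in>C. \<forall>i\<in>S. h i r = (1 - t) * h i p + t * h i q"
    and "\<And>w. (\<forall>i\<in>S. 0 \<le> w i) \<Longrightarrow> sum w S = 1 \<Longrightarrow> \<exists>p\<in>C. (\<Sum>i\<in>S. w i * h i p) \<le> c"
    and "0 < e"
  shows "\<exists>p\<in>C. \<forall>i\<in>S. h i p \<le> c + e"
  using assms
proof (induction S arbitrary: C c e rule: finite_induct)
  case empty
  then show ?case by auto
next
  case (insert k S)
  note mix = insert.prems(2) and dual = insert.prems(3)
  show ?case
  proof (rule ccontr)
    assume contra: "\<not> ?case"
    define C' where "C' = {p\<in>C. h k p \<le> c + e}"
    have "\<exists>w. (\<forall>i\<in>S. 0 \<le> w i) \<and> sum w S = 1 \<and> (\<forall>p\<in>C'. c + e/2 < (\<Sum>i\<in>S. w i * h i p))"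
    proof (rule ccontr)
      assume no_weights: "\<not> ?thesis"
      have "\<exists>p\<in>C'. \<forall>i\<in>S. h i p \<le> (c + e/2) + e/2"
      proof (rule insert.IH)
        have "sum (\<lambda>i. if i = k then 1 else 0 :: real) (insert k S) = 1"
          using insert.hyps by (simp add: sum.delta)
        then have "\<exists>p\<in>C. (\<Sum>i\<in>insert k S. (if i = k then 1 else 0) * h i p) \<le> c"
          by (intro dual) auto
        then obtain p where
          "p \<in> C" "(\<Sum>i\<in>insert k S. (if i = k then 1 else 0) * h i p) \<le> c"
          by blast
        moreover have "(\<Sum>i\<in>insert k S. (if i = k then 1 else 0) * h i p) = h k p"
          using insert.hyps by (simp add: if_distrib[of "\<lambda>u. u * _"] cong: if_cong)
        ultimately show "C' \<noteq> {}"
          using \<open>0 < e\<close> by (auto simp: C'_def)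
      next
        fix p q and t :: real
        assume pq: "p \<in> C'" "q \<in> C'" and t: "0 \<le> t" "t \<le> 1"
        then obtain r where r: "r \<in> C" "\<forall>i\<in>insert k S. h i r = (1 - t) * h i p + t * h i q"
          using mix[of p q t] by (auto simp: C'_def)
        have "h k r \<le> (1 - t) * (c + e) + t * (c + e)"
          using r(2) pq t by (auto simp: C'_def intro!: add_mono mult_left_mono)
        then have "r \<in> C'"
          using r(1) by (simp add: C'_def algebra_simps)
        then show "\<exists>r\<in>C'. \<forall>i\<in>S. h i r = (1 - t) * h i p + t * h i q"
          using r(2) by auto
      next
        fix w :: "'i \<Rightarrow> real" assume "\<forall>i\<in>S. 0 \<le> w i" "sum w S = 1"
        then show "\<exists>p\<in>C'. (\<Sum>i\<in>S. w i * h i p) \<le> c + e/2"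
          using no_weights by (meson not_less)
      qed (use \<open>0 < e\<close> in auto)
      then show False
        using contra by (auto simp: C'_def add.commute)
    qed
    then obtain w where w: "\<forall>i\<in>S. 0 \<le> w i" "sum w S = 1"
      and G_large: "\<And>p. p \<in> C' \<Longrightarrow> c + e/2 < (\<Sum>i\<in>S. w i * h i p)"
      by blast
    define G where "G p = (\<Sum>i\<in>S. w i * h i p)" for p
    define A where "A = (\<lambda>p. (G p, h k p)) ` C"
    define Q where "Q = {..c + e/2} \<times> {..c + e}"
    have "convex A"
      unfolding convex_alt
    proof (intro ballI allI impI)
      fix a b and t :: real
      assume "a \<in> A" "b \<in> A" and t: "0 \<le> t \<and> t \<le> 1"
      then obtain p q where pq: "p \<in> C" "q \<in> C" "a = (G p, h k p)" "b = (G q, h k q)"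
        by (auto simp: A_def)
      obtain r where r: "r \<in> C" "\<forall>i\<in>insert k S. h i r = (1 - t) * h i p + t * h i q"
        using mix[OF pq(1,2)] t by blast
      have "G r = (1 - t) * G p + t * G q"
        unfolding G_def sum_distrib_left sum.distrib[symmetric]
        by (intro sum.cong refl) (simp add: r(2) distrib_left mult.left_commute)
      then have "(1 - t) *\<^sub>R a + t *\<^sub>R b = (G r, h k r)"
        using r(2) pq by simp
      then show "(1 - t) *\<^sub>R a + t *\<^sub>R b \<in> A"
        using r(1) by (auto simp: A_def)
    qed
    moreover have "convex Q"
      unfolding Q_def by (intro convex_Times convex_real_interval)
    moreover have "A \<noteq> {}" "Q \<noteq> {}" "Q \<inter> A = {}"
      using \<open>C \<noteq> {}\<close> G_large by (auto simp: A_def Q_def C'_def G_def not_less[symmetric])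
    ultimately obtain a b where "a \<noteq> 0" and
      Qb: "\<And>x. x \<in> Q \<Longrightarrow> inner a x \<le> b" and Ab: "\<And>x. x \<in> A \<Longrightarrow> b \<le> inner a x"
      using separating_hyperplane_sets[of Q A] by metis
    obtain \<alpha> \<beta> where ab: "a = (\<alpha>, \<beta>)" by fastforce
    define d where "d = b - \<alpha> * (c + e/2) - \<beta> * (c + e)"
    \<comment> \<open>Since the quadrant \<open>Q\<close> is unbounded below, the separating functional is nonnegative.\<close>
    have corner: "- \<alpha> * s - \<beta> * s' \<le> d" if "0 \<le> s" "0 \<le> s'" for s s'
      using Qb[of "(c + e/2 - s, c + e - s')"] that by (simp add: Q_def ab d_def algebra_simps)
    have d0: "0 \<le> d"
      using corner[of 0 0] by simp
    have \<alpha>: "0 \<le> \<alpha>"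
    proof (rule ccontr)
      assume "\<not> 0 \<le> \<alpha>"
      then show False
        using corner[of "(d + 1) / (- \<alpha>)" 0] d0 by (simp add: field_simps)
    qed
    have \<beta>: "0 \<le> \<beta>"
    proof (rule ccontr)
      assume "\<not> 0 \<le> \<beta>"
      then show False
        using corner[of 0 "(d + 1) / (- \<beta>)"] d0 by (simp add: field_simps)
    qed
    have pos: "0 < \<alpha> + \<beta>"
      using \<alpha> \<beta> \<open>a \<noteq> 0\<close> by (auto simp: ab zero_prod_def)
    \<comment> \<open>Mixing the old weights with the new constraint in the ratio given by the functional contradicts the dual hypothesis.\<close>
    define v where "v i = (if i = k then \<beta> else \<alpha> * w i) / (\<alpha> + \<beta>)" for i
    have split: "(\<Sum>i\<in>insert k S. v i * g i) = (\<beta> * g k + \<alpha> * (\<Sum>i\<in>S. w i * g i)) / (\<alpha> + \<beta>)"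
      for g
    proof -
      have "(\<Sum>i\<in>S. v i * g i) = (\<Sum>i\<in>S. \<alpha> / (\<alpha> + \<beta>) * (w i * g i))"
        using insert.hyps by (intro sum.cong) (auto simp: v_def)
      also have "\<dots> = \<alpha> / (\<alpha> + \<beta>) * (\<Sum>i\<in>S. w i * g i)"
        by (simp only: sum_distrib_left)
      finally show ?thesis
        unfolding sum.insert[OF insert.hyps] by (simp add: v_def add_divide_distrib)
    qed
    have "sum v (insert k S) = 1"
      using split[of "\<lambda>_. 1"] w(2) pos by simp
    moreover have "\<forall>i\<in>insert k S. 0 \<le> v i"
      using \<alpha> \<beta> w(1) by (auto simp: v_def)
    ultimately obtain p where p: "p \<in> C" "(\<Sum>i\<in>insert k S. v i * h i p) \<le> c"
      using dual by blast
    have "\<alpha> * (c + e/2) + \<beta> * (c + e) \<le> \<alpha> * G p + \<beta> * h k p"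
      using Ab[of "(G p, h k p)"] p(1) d0 by (auto simp: A_def ab d_def)
    also have "\<dots> \<le> c * (\<alpha> + \<beta>)"
      using p(2) pos unfolding split by (simp add: G_def field_simps)
    finally have "(\<alpha> + \<beta>) * (e/2) + \<beta> * (e/2) \<le> 0"
      by (simp add: algebra_simps add_divide_distrib)
    moreover have "0 < (\<alpha> + \<beta>) * (e/2)" "0 \<le> \<beta> * (e/2)"
      using pos \<beta> \<open>0 < e\<close> by auto
    ultimately show False by linarith
  qed
qed

lemma finite_pmf_mixture:
  fixes p q :: "'a pmf" and t :: real
  assumes "finite (set_pmf p)" "finite (set_pmf q)" "0 \<le> t" "t \<le> 1"
  shows "\<exists>r. finite (set_pmf r) \<and> set_pmf r \<subseteq> set_pmf p \<union> set_pmf q \<and>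
    (\<forall>h :: 'a \<Rightarrow> real. measure_pmf.expectation r h =
       (1 - t) * measure_pmf.expectation p h + t * measure_pmf.expectation q h)"
proof -
  define r where "r = bind_pmf (bernoulli_pmf t) (\<lambda>b. if b then q else p)"
  define A where "A = set_pmf p \<union> set_pmf q"
  have A: "finite A" "set_pmf p \<subseteq> A" "set_pmf q \<subseteq> A"
    using assms by (auto simp: A_def)
  have r_A: "set_pmf r \<subseteq> A"
    by (auto simp: r_def A_def split: if_splits)
  have mass: "pmf r a = (1 - t) * pmf p a + t * pmf q a" for a
    using assms(3,4) by (simp add: r_def pmf_bind)
  show ?thesis
  proof (intro exI[of _ r] conjI allI)
    show "finite (set_pmf r)" using r_A A(1) by (rule finite_subset)
    show "set_pmf r \<subseteq> set_pmf p \<union> set_pmf q" using r_A by (simp add: A_def)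
    fix h :: "'a \<Rightarrow> real"
    have E: "measure_pmf.expectation s h = (\<Sum>a\<in>A. h a * pmf s a)" if "set_pmf s \<subseteq> A" for s
      using A(1) that by (intro integral_measure_pmf_real) auto
    show "measure_pmf.expectation r h =
        (1 - t) * measure_pmf.expectation p h + t * measure_pmf.expectation q h"
      unfolding E[OF r_A] E[OF A(2)] E[OF A(3)] mass
      unfolding sum_distrib_left sum.distrib[symmetric]
      by (intro sum.cong refl) (simp add: distrib_left mult.left_commute)
  qed
qed

text \<open>
  The minimax lemma for finitely many points \<open>x\<close> of a game, with the finitely supported mixed
  strategies on \<open>K\<close> as abstract convex set. Expectations of such strategies are finite sums, hence affine under mixing.
\<close>

lemma dual_pmf_for_finitely_many_constraints:
  fixes f :: "'a \<Rightarrow> 'b \<Rightarrow> real"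
  assumes S: "finite S" and "K \<noteq> {}"
    and primal: "\<And>p. set_pmf p \<subseteq> S \<Longrightarrow> \<exists>w\<in>K. measure_pmf.expectation p (\<lambda>x. f x w) \<le> c"
    and "0 < e"
  shows "\<exists>q. set_pmf q \<subseteq> K \<and> (\<forall>x\<in>S. measure_pmf.expectation q (f x) \<le> c + e)"
proof -
  define C where "C = {q. finite (set_pmf q) \<and> set_pmf q \<subseteq> K}"
  have "\<exists>q\<in>C. \<forall>x\<in>S. measure_pmf.expectation q (f x) \<le> c + e"
  proof (rule finite_minimax[OF S])
    obtain w where "w \<in> K" using \<open>K \<noteq> {}\<close> by blast
    then have "return_pmf w \<in> C" by (simp add: C_def)
    then show "C \<noteq> {}" by blast
  next
    fix p q and t :: real assume pq: "p \<in> C" "q \<in> C" and t: "0 \<le> t" "t \<le> 1"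
    then have "\<exists>r. finite (set_pmf r) \<and> set_pmf r \<subseteq> set_pmf p \<union> set_pmf q \<and>
        (\<forall>h :: 'b \<Rightarrow> real. measure_pmf.expectation r h =
         (1 - t) * measure_pmf.expectation p h + t * measure_pmf.expectation q h)"
      by (intro finite_pmf_mixture) (auto simp: C_def)
    then obtain r where r: "finite (set_pmf r)" "set_pmf r \<subseteq> set_pmf p \<union> set_pmf q"
      "\<And>h :: 'b \<Rightarrow> real. measure_pmf.expectation r h =
         (1 - t) * measure_pmf.expectation p h + t * measure_pmf.expectation q h"
      by blast
    then have "r \<in> C" using pq by (auto simp: C_def)
    then show "\<exists>r\<in>C. \<forall>i\<in>S. measure_pmf.expectation r (f i) =
        (1 - t) * measure_pmf.expectation p (f i) + t * measure_pmf.expectation q (f i)"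
      using r(3) by blast
  next
    fix v :: "'a \<Rightarrow> real" assume v: "\<forall>i\<in>S. 0 \<le> v i" "sum v S = 1"
    define p where "p = embed_pmf (\<lambda>x. if x \<in> S then v x else 0)"
    have nonneg: "0 \<le> (if x \<in> S then v x else 0)" for x using v(1) by simp
    have "(\<integral>\<^sup>+x. ennreal (if x \<in> S then v x else 0) \<partial>count_space UNIV) = (\<Sum>x\<in>S. ennreal (v x))"
      by (subst nn_integral_count_space'[OF S]) auto
    also have "\<dots> = 1"
      using v by (simp add: sum_ennreal)
    finally have pmf_p: "pmf p x = (if x \<in> S then v x else 0)" for x
      unfolding p_def by (intro pmf_embed_pmf nonneg)
    have p_S: "set_pmf p \<subseteq> S"
      by (auto simp: set_pmf_eq pmf_p split: if_splits)
    then obtain w where w: "w \<in> K" "measure_pmf.expectation p (\<lambda>x. f x w) \<le> c"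
      using primal by blast
    have "measure_pmf.expectation p (\<lambda>x. f x w) = (\<Sum>x\<in>S. f x w * pmf p x)"
      using S p_S by (intro integral_measure_pmf_real) auto
    also have "\<dots> = (\<Sum>x\<in>S. v x * f x w)"
      by (intro sum.cong) (auto simp: pmf_p)
    finally show "\<exists>q\<in>C. (\<Sum>i\<in>S. v i * measure_pmf.expectation q (f i)) \<le> c"
      using w by (intro bexI[of _ "return_pmf w"]) (auto simp: C_def)
  qed fact
  then show ?thesis by (auto simp: C_def)
qed

section \<open>A space-filling curve\<close>

lemma binary_expansion_sums:
  fixes y :: real
  assumes "0 \<le> y" "y < 1"
  shows "(\<lambda>k. real_of_int (\<lfloor>2 ^ Suc k * y\<rfloor> mod 2) / 2 ^ Suc k) sums y"
proof -
  have partial: "(\<Sum>k<n. real_of_int (\<lfloor>2 ^ Suc k * y\<rfloor> mod 2) / 2 ^ Suc k) = real_of_int \<lfloor>2 ^ n * y\<rfloor> / 2 ^ n"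
    for n
  proof (induction n)
    case 0
    have "\<lfloor>y\<rfloor> = 0" using assms by linarith
    then show ?case by simp
  next
    case (Suc n)
    have "\<lfloor>2 ^ Suc n * y\<rfloor> div 2 = \<lfloor>2 ^ n * y\<rfloor>"
      using floor_divide_real_eq_div[of 2 "2 ^ Suc n * y"] by simp
    then have "\<lfloor>2 ^ Suc n * y\<rfloor> = 2 * \<lfloor>2 ^ n * y\<rfloor> + \<lfloor>2 ^ Suc n * y\<rfloor> mod 2"
      by (metis mult_div_mod_eq)
    then have "real_of_int \<lfloor>2 ^ Suc n * y\<rfloor> = 2 * real_of_int \<lfloor>2 ^ n * y\<rfloor> + real_of_int (\<lfloor>2 ^ Suc n * y\<rfloor> mod 2)"
      by linarith
    then show ?case
      unfolding sum.lessThan_Suc Suc by (simp add: field_simps)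
  qed
  have "(\<lambda>n. real_of_int \<lfloor>2 ^ n * y\<rfloor> / 2 ^ n) \<longlonglongrightarrow> y"
  proof (rule real_tendsto_sandwich)
    show "(\<lambda>n. y - (1/2) ^ n) \<longlonglongrightarrow> y"
      using tendsto_diff[OF tendsto_const LIMSEQ_power_zero[of "1/2::real"]] by simp
    have "y - (1/2) ^ n \<le> real_of_int \<lfloor>2 ^ n * y\<rfloor> / 2 ^ n" for n
    proof -
      have "2 ^ n * y - 1 \<le> real_of_int \<lfloor>2 ^ n * y\<rfloor>" by linarith
      then have "(2 ^ n * y - 1) / 2 ^ n \<le> real_of_int \<lfloor>2 ^ n * y\<rfloor> / 2 ^ n"
        by (rule divide_right_mono) simp
      then show ?thesis by (simp add: diff_divide_distrib power_divide)
    qed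
    then show "\<forall>\<^sub>F n in sequentially. y - (1/2) ^ n \<le> real_of_int \<lfloor>2 ^ n * y\<rfloor> / 2 ^ n" by simp
    have "real_of_int \<lfloor>2 ^ n * y\<rfloor> / 2 ^ n \<le> y" for n
      by (simp add: divide_le_eq mult.commute)
    then show "\<forall>\<^sub>F n in sequentially. real_of_int \<lfloor>2 ^ n * y\<rfloor> / 2 ^ n \<le> y" by simp
  qed simp
  then show ?thesis
    unfolding sums_def partial .
qed

text \<open>
  A continuous wave of period 2 that vanishes on \<open>[0, 1/3]\<close> and equals 1 on \<open>[2/3, 1]\<close>. If \<open>t \<in> [0, 1]\<close> is
  written in base 3 with digits 0 and 2 alone, the value of the wave at \<open>3\<^sup>n t\<close> is therefore half of the digit with index
  \<open>n\<close>.
\<close>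

definition schoenberg_wave :: "real \<Rightarrow> real" where
  "schoenberg_wave s = max 0 (min 1 (1/2 - cos (pi * s)))"

lemma schoenberg_wave_bounds: "0 \<le> schoenberg_wave s" "schoenberg_wave s \<le> 1"
  by (auto simp: schoenberg_wave_def)

lemma schoenberg_wave_periodic: "schoenberg_wave (2 * real_of_int m + s) = schoenberg_wave s"
proof -
  have "cos (pi * (2 * real_of_int m + s)) = cos (pi * s)"
    using cos_int_2pin[of m] sin_int_2pin[of m] by (simp add: cos_add algebra_simps)
  then show ?thesis by (simp add: schoenberg_wave_def)
qed

lemma schoenberg_wave_digit:
  assumes "0 \<le> s" "s \<le> 1"
  shows "schoenberg_wave (s / 3) = 0" "schoenberg_wave (2 / 3 + s / 3) = 1"
proof -
  have "cos (pi / 3) \<le> cos (pi * (s / 3))"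
    using assms by (intro cos_monotone_0_pi_le) (auto simp: field_simps)
  then show "schoenberg_wave (s / 3) = 0"
    by (simp add: schoenberg_wave_def cos_60)
  have "cos (pi / 3) \<le> cos (pi * ((1 - s) / 3))"
    using assms by (intro cos_monotone_0_pi_le) (auto simp: field_simps)
  moreover have "cos (pi * (2 / 3 + s / 3)) = - cos (pi * ((1 - s) / 3))"
  proof -
    have "pi * (2 / 3 + s / 3) = pi - pi * ((1 - s) / 3)" by (simp add: field_simps)
    then show ?thesis by (simp only: cos_pi_minus)
  qed
  ultimately show "schoenberg_wave (2 / 3 + s / 3) = 1"
    by (simp add: schoenberg_wave_def cos_60)
qed

text \<open>
  The point \<open>t\<close> is the element of the Cantor set with ternary digits \<open>2 a\<^sub>0, 2 a\<^sub>1, \<dots>\<close>. Multiplication by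
  \<open>3\<^sup>n\<close> shifts the digits, and the digits that pass the ternary point contribute an even integer, a
  multiple of the period.
\<close>

lemma schoenberg_wave_reads_digits:
  fixes a :: "nat \<Rightarrow> int"
  assumes a: "\<And>k. a k \<in> {0, 1}"
  obtains t where "0 \<le> t" "t \<le> 1" "\<And>n. schoenberg_wave (3 ^ n * t) = real_of_int (a n)"
proof -
  define T where "T b = (\<Sum>k. 2 * real_of_int (b k) / 3 ^ Suc k)" for b :: "nat \<Rightarrow> int"
  have geo: "(\<lambda>k. 2 / 3 ^ Suc k :: real) sums 1"
    using sums_mult[OF geometric_sums[of "1/3 :: real"], of "2/3"] by (simp add: power_divide)
  have T: "summable (\<lambda>k. 2 * real_of_int (b k) / 3 ^ Suc k)" "0 \<le> T b" "T b \<le> 1"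
      "3 * T b = 2 * b 0 + T (\<lambda>k. b (Suc k))" if b: "\<And>k. b k \<in> {0, 1}" for b :: "nat \<Rightarrow> int"
  proof -
    have le: "0 \<le> 2 * real_of_int (b k) / 3 ^ Suc k" "2 * real_of_int (b k) / 3 ^ Suc k \<le> 2 / 3 ^ Suc k"
      for k
      using b[of k] by auto
    show sm: "summable (\<lambda>k. 2 * real_of_int (b k) / 3 ^ Suc k)"
      by (rule summable_comparison_test'[OF sums_summable[OF geo], of 0])
        (simp only: real_norm_def abs_of_nonneg[OF le(1)] le(2))
    show "0 \<le> T b"
      unfolding T_def by (intro suminf_nonneg sm le)
    show "T b \<le> 1"
      using suminf_le[OF le(2) sm sums_summable[OF geo]] sums_unique[OF geo] by (simp add: T_def)
    have "T b = (\<Sum>k. 2 * real_of_int (b (Suc k)) / 3 ^ Suc (Suc k)) + 2 * real_of_int (b 0) / 3"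
      using suminf_split_head[OF sm] by (simp add: T_def)
    also have "(\<Sum>k. 2 * real_of_int (b (Suc k)) / 3 ^ Suc (Suc k)) = T (\<lambda>k. b (Suc k)) / 3"
    proof -
      have "summable (\<lambda>k. 2 * real_of_int (b (Suc k)) / 3 ^ Suc k)"
      proof -
        have "summable (\<lambda>k. 3 * (2 * real_of_int (b (Suc k)) / 3 ^ Suc (Suc k)))"
          using sm by (intro summable_mult) (subst summable_Suc_iff)
        then show ?thesis by simp
      qed
      from suminf_divide[OF this, of 3] show ?thesis by (simp add: T_def mult.commute mult.left_commute)
    qed
    finally show "3 * T b = 2 * b 0 + T (\<lambda>k. b (Suc k))" by simp
  qed
  have shift: "\<exists>m. 3 ^ n * T a = 2 * real_of_int m + T (\<lambda>k. a (k + n))" for n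
  proof (induction n)
    case 0
    show ?case by (rule exI[of _ 0]) simp
  next
    case (Suc n)
    then obtain m where m: "3 ^ n * T a = 2 * real_of_int m + T (\<lambda>k. a (k + n))" by blast
    have "3 * T (\<lambda>k. a (k + n)) = 2 * a n + T (\<lambda>k. a (k + Suc n))"
      using T(4)[of "\<lambda>k. a (k + n)"] a by simp
    then have "3 ^ Suc n * T a = 2 * real_of_int (3 * m + a n) + T (\<lambda>k. a (k + Suc n))"
      using m by simp
    then show ?case by blast
  qed
  show thesis
  proof
    show "0 \<le> T a" "T a \<le> 1" using T a by auto
    fix n
    obtain m where m: "3 ^ n * T a = 2 * real_of_int m + T (\<lambda>k. a (k + n))" using shift by blast
    define s where "s = T (\<lambda>k. a (Suc k + n))"
    have s: "0 \<le> s" "s \<le> 1" unfolding s_def using T a by auto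
    have "3 * T (\<lambda>k. a (k + n)) = 2 * a n + s"
      using T(4)[of "\<lambda>k. a (k + n)"] a by (simp add: s_def)
    then have "T (\<lambda>k. a (k + n)) = (2 * real_of_int (a n) + s) / 3" by simp
    then have "schoenberg_wave (3 ^ n * T a) = schoenberg_wave ((2 * real_of_int (a n) + s) / 3)"
      unfolding m by (simp only: schoenberg_wave_periodic)
    then show "schoenberg_wave (3 ^ n * T a) = real_of_int (a n)"
      using schoenberg_wave_digit[OF s] a[of n] by (auto simp: add_divide_distrib)
  qed
qed

text \<open>
  Schoenberg's space-filling curve, with countably many coordinates at once: digit \<open>k\<close> of
  coordinate \<open>j\<close> is read off the ternary digit of \<open>t\<close> with index \<open>prod_encode (k, j)\<close>.
\<close>

definition schoenberg_curve :: "nat \<Rightarrow> real \<Rightarrow> real" where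
  "schoenberg_curve j t = (\<Sum>k. schoenberg_wave (3 ^ prod_encode (k, j) * t) / 2 ^ Suc k)"

lemma continuous_on_schoenberg_curve: "continuous_on UNIV (schoenberg_curve j)"
proof (rule uniform_limit_theorem)
  show "uniform_limit UNIV (\<lambda>n t. \<Sum>k<n. schoenberg_wave (3 ^ prod_encode (k, j) * t) / 2 ^ Suc k)
      (schoenberg_curve j) sequentially"
    unfolding schoenberg_curve_def[abs_def]
  proof (rule Weierstrass_m_test)
    show "summable (\<lambda>k. 1 / 2 ^ Suc k :: real)"
      using sums_mult[OF geometric_sums[of "1/2 :: real"], of "1/2"]
      by (auto simp: power_divide dest: sums_summable)
  qed (auto simp: schoenberg_wave_bounds divide_right_mono)
  show "\<forall>\<^sub>F n in sequentially. continuous_on UNIV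
      (\<lambda>t. \<Sum>k<n. schoenberg_wave (3 ^ prod_encode (k, j) * t) / 2 ^ Suc k)"
    unfolding schoenberg_wave_def by (intro always_eventually allI continuous_intros) auto
qed simp

lemma schoenberg_curve_onto:
  fixes y :: "nat \<Rightarrow> real"
  assumes "\<And>j. 0 \<le> y j" "\<And>j. y j < 1"
  obtains t where "0 \<le> t" "t \<le> 1" "\<And>j. schoenberg_curve j t = y j"
proof -
  define a where "a n = (case prod_decode n of (k, j) \<Rightarrow> \<lfloor>2 ^ Suc k * y j\<rfloor> mod 2)" for n
  have "a n \<in> {0, 1}" for n
    by (auto simp: a_def split: prod.split)
  then obtain t where t: "0 \<le> t" "t \<le> 1" "\<And>n. schoenberg_wave (3 ^ n * t) = real_of_int (a n)"
    using schoenberg_wave_reads_digits by metis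
  have "schoenberg_curve j t = y j" for j
    using sums_unique[OF binary_expansion_sums[of "y j"]] assms
    by (simp add: schoenberg_curve_def t(3) a_def)
  then show thesis using that t by blast
qed

section \<open>Weak limits of discrete measures on a compact set\<close>

text \<open>
  Discarding a null set turns a probability measure on \<open>A\<close> into one on \<open>B \<subseteq> A\<close> with the same integrals.
\<close>

lemma
  fixes f :: "'a::topological_space \<Rightarrow> real"
  assumes \<mu>: "\<mu> \<in> prob_measures A" and B: "B \<subseteq> A" "B \<in> sets \<mu>" and full: "AE x in \<mu>. x \<in> B"
  shows restrict_in_prob_measures: "restrict_space \<mu> B \<in> prob_measures B"
    and integral_restrict_full:
      "f \<in> borel_measurable \<mu> \<Longrightarrow> (\<integral>x. f x \<partial>restrict_space \<mu> B) = (\<integral>x. f x \<partial>\<mu>)"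
proof -
  interpret prob_space \<mu> using \<mu> by (simp add: prob_measures_def)
  have sets_eq: "sets \<mu> = sets (restrict_space borel A)"
    using \<mu> by (simp add: prob_measures_def)
  have "emeasure \<mu> B = 1"
    using full B(2) by (simp add: emeasure_eq_1_AE)
  then have "prob_space (restrict_space \<mu> B)"
    using B(2) by (rule prob_space_restrict_space[rotated])
  moreover have "sets (restrict_space \<mu> B) = sets (restrict_space borel B)"
    using B(1) by (simp add: sets_restrict_space_cong[OF sets_eq] sets_restrict_restrict_space Int_absorb1)
  ultimately show "restrict_space \<mu> B \<in> prob_measures B"
    by (simp add: prob_measures_def)
  have [simp]: "B \<inter> space \<mu> \<in> sets \<mu>" using B(2) by simp
  assume f: "f \<in> borel_measurable \<mu>"
  show "(\<integral>x. f x \<partial>restrict_space \<mu> B) = (\<integral>x. f x \<partial>\<mu>)"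
    unfolding integral_restrict_space[OF \<open>B \<inter> space \<mu> \<in> sets \<mu>\<close>]
    using full f B(2) by (intro integral_cong_AE) auto
qed

lemma bounded_subset_image_of_interval:
  fixes K :: "'b::euclidean_space set"
  assumes "bounded K"
  obtains g :: "real \<Rightarrow> 'b" where "continuous_on UNIV g" "K \<subseteq> g ` {0..1}"
proof -
  obtain B where "0 < B" and B: "\<And>x. x \<in> K \<Longrightarrow> norm x < B"
    using assms by (auto simp: bounded_pos_less)
  define code where "code = to_nat_on (Basis :: 'b set)"
  define g where "g t = (\<Sum>i\<in>Basis. (2 * B * schoenberg_curve (code i) t - B) *\<^sub>R i)" for t :: real
  have "continuous_on UNIV g"
    unfolding g_def by (intro continuous_intros continuous_on_schoenberg_curve)
  moreover have "x \<in> g ` {0..1}" if "x \<in> K" for x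
  proof -
    define y where "y j = (if j \<in> code ` Basis then (inner x (from_nat_into Basis j) + B) / (2 * B) else 0)"
      for j
    have decode: "from_nat_into Basis (code i) = i" if "i \<in> Basis" for i :: 'b
      using that by (simp add: code_def countable_finite)
    have small: "\<bar>inner x i\<bar> < B" if "i \<in> Basis" for i
      using Basis_le_norm[OF that, of x] B[OF \<open>x \<in> K\<close>] by simp
    have "0 \<le> y j \<and> y j < 1" for j
      using small \<open>0 < B\<close> by (force simp: y_def decode field_simps abs_less_iff)
    then obtain t where t: "0 \<le> t" "t \<le> 1" "\<And>j. schoenberg_curve j t = y j"
      using schoenberg_curve_onto[of y] by blast
    have "g t = (\<Sum>i\<in>Basis. inner x i *\<^sub>R i)"
      unfolding g_def t(3) using \<open>0 < B\<close> by (intro sum.cong) (auto simp: y_def decode)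
    then show ?thesis
      using t(1,2) by (auto simp: euclidean_representation intro!: image_eqI[of _ _ t])
  qed
  ultimately show thesis using that by blast
qed

text \<open>
  Prokhorov's theorem for discrete measures on a compact set. The curve \<open>g\<close> maps an interval onto a
  set containing \<open>K\<close>, and \<open>\<sigma>\<close> chooses a preimage of every point of \<open>K\<close>. An arbitrary choice
  lifts the given measures, because they are discrete. On the line Helly's theorem
  provides a weak limit, and its image under \<open>g\<close> is the measure sought. Testing with the
  distance of \<open>g t\<close> from \<open>K\<close> shows that the limit still lives on \<open>K\<close>.
\<close>

lemma pmf_on_compact_weakly_convergent_subseq:
  fixes K :: "'b::euclidean_space set" and P :: "nat \<Rightarrow> 'b pmf"
  assumes K: "compact K" and P: "\<And>n. set_pmf (P n) \<subseteq> K"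
  obtains \<mu> r where "strict_mono (r :: nat \<Rightarrow> nat)" "\<mu> \<in> prob_measures K"
    "\<And>h :: 'b \<Rightarrow> real. continuous_on K h \<Longrightarrow>
       (\<lambda>n. measure_pmf.expectation (P (r n)) h) \<longlonglongrightarrow> (\<integral>x. h x \<partial>\<mu>)"
proof -
  have "K \<noteq> {}" using P[of 0] set_pmf_not_empty[of "P 0"] by blast
  obtain g :: "real \<Rightarrow> 'b" where g: "continuous_on UNIV g" "K \<subseteq> g ` {0..1}"
    using bounded_subset_image_of_interval[OF compact_imp_bounded[OF K]] .
  then have "\<forall>x\<in>K. \<exists>t. t \<in> {0..1} \<and> g t = x" by blast
  then obtain \<sigma> where \<sigma>: "\<And>x. x \<in> K \<Longrightarrow> \<sigma> x \<in> {0..1} \<and> g (\<sigma> x) = x"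
    by metis
  define M where "M n = distr (measure_pmf (P n)) borel \<sigma>" for n
  have dist: "real_distribution (M n)" for n
    unfolding M_def by (rule prob_space.real_distribution_distr) (auto simp: measure_pmf.prob_space_axioms)
  have M_int: "(\<integral>t. \<phi> t \<partial>M n) = measure_pmf.expectation (P n) (\<lambda>x. \<phi> (\<sigma> x))"
    if "continuous_on UNIV \<phi>" for \<phi> :: "real \<Rightarrow> real" and n
    unfolding M_def using that by (intro integral_distr) (auto intro: borel_measurable_continuous_onI)
  have P_cong: "measure_pmf.expectation (P n) h = measure_pmf.expectation (P n) h'"
    if "\<And>x. x \<in> K \<Longrightarrow> h x = h' x" for h h' :: "'b \<Rightarrow> real" and n
    using that P[of n] by (intro integral_cong_AE) (auto simp: AE_measure_pmf_iff)
  have "tight M"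
    unfolding tight_def
  proof (intro conjI allI impI dist)
    fix \<epsilon> :: real assume "0 < \<epsilon>"
    have "measure (M n) {-1<..1} = 1" for n
    proof -
      have "measure (M n) {-1<..1} = measure (P n) (\<sigma> -` {-1<..1})"
        by (simp add: M_def measure_distr)
      also have "\<dots> = 1"
        using \<sigma> P[of n] by (subst measure_pmf.prob_eq_1) (force simp: AE_measure_pmf_iff)+
      finally show ?thesis .
    qed
    then show "\<exists>a b. a < b \<and> (\<forall>n. 1 - \<epsilon> < measure (M n) {a<..b})"
      using \<open>0 < \<epsilon>\<close> by (intro exI[of _ "-1"] exI[of _ 1]) simp
  qed
  then obtain r M0 where r: "strict_mono (r :: nat \<Rightarrow> nat)" and M0: "real_distribution M0"
    and weak: "weak_conv_m (M \<circ> id \<circ> r) M0"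
    using tight_imp_convergent_subsubsequence[of M id] by (auto simp: strict_mono_def)
  interpret M0: real_distribution M0 by fact
  have conv: "(\<lambda>n. \<integral>t. \<phi> t \<partial>M (r n)) \<longlonglongrightarrow> (\<integral>t. \<phi> t \<partial>M0)"
    if "continuous_on UNIV \<phi>" "\<And>t. \<bar>\<phi> t\<bar> \<le> B" for \<phi> :: "real \<Rightarrow> real" and B
    using weak_conv_imp_integral_bdd_continuous_conv[of "M \<circ> id \<circ> r" M0 \<phi> B] dist M0 weak that
    by (simp add: continuous_on_eq_continuous_at)
  have g_meas[measurable]: "g \<in> borel_measurable M0"
    using borel_measurable_continuous_onI[OF g(1)] by simp
  have "AE t in M0. g t \<in> K"
  proof -
    define \<phi> where "\<phi> t = min 1 (infdist (g t) K)" for t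
    have cont: "continuous_on UNIV \<phi>"
      unfolding \<phi>_def by (intro continuous_intros g(1))
    have bound: "\<bar>\<phi> t\<bar> \<le> 1" "0 \<le> \<phi> t" for t
      by (auto simp: \<phi>_def infdist_nonneg)
    have "(\<integral>t. \<phi> t \<partial>M n) = 0" for n
    proof -
      have "measure_pmf.expectation (P n) (\<lambda>x. \<phi> (\<sigma> x)) = measure_pmf.expectation (P n) (\<lambda>_. 0)"
        using \<sigma> by (intro P_cong) (simp add: \<phi>_def)
      then show ?thesis by (simp add: M_int[OF cont])
    qed
    then have "(\<integral>t. \<phi> t \<partial>M0) = 0"
      using conv[OF cont bound(1)] by (simp add: LIMSEQ_const_iff)
    moreover have "integrable M0 \<phi>"
      using bound borel_measurable_continuous_onI[OF cont]
      by (intro M0.integrable_const_bound[of _ 1]) auto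
    ultimately have "AE t in M0. \<phi> t = 0"
      using bound by (subst (asm) integral_nonneg_eq_0_iff_AE) auto
    then show ?thesis
    proof (rule AE_mp, intro AE_I2 impI)
      fix t assume "\<phi> t = 0"
      then have "infdist (g t) K = 0" by (simp add: \<phi>_def min_def split: if_splits)
      then show "g t \<in> K"
        using in_closed_iff_infdist_zero[OF compact_imp_closed[OF K] \<open>K \<noteq> {}\<close>] by blast
    qed
  qed
  define \<nu> where "\<nu> = distr M0 borel g"
  have K_borel: "K \<in> sets borel" using K by (simp add: borel_compact)
  have \<nu>: "\<nu> \<in> prob_measures UNIV"
    unfolding \<nu>_def prob_measures_def by (simp add: M0.prob_space_distr)
  have "AE x in \<nu>. x \<in> K"
    unfolding \<nu>_def using \<open>AE t in M0. g t \<in> K\<close> K_borel by (subst AE_distr_iff) auto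
  note full = \<nu> subset_UNIV _ this
  define \<mu> where "\<mu> = restrict_space \<nu> K"
  have K_\<nu>: "K \<in> sets \<nu>" using K_borel by (simp add: \<nu>_def)
  show thesis
  proof
    show "strict_mono r" by fact
    show "\<mu> \<in> prob_measures K"
      unfolding \<mu>_def by (rule restrict_in_prob_measures[OF full]) fact
    fix h :: "'b \<Rightarrow> real" assume h: "continuous_on K h"
    have "bounded (h ` K)"
      using compact_continuous_image[OF h K] compact_imp_bounded by blast
    then obtain B where "0 < B" "\<And>x. x \<in> K \<Longrightarrow> norm (h x) \<le> B"
      by (auto simp: bounded_pos)
    then obtain h' where h': "continuous_on UNIV h'" "\<And>x. x \<in> K \<Longrightarrow> h' x = h x" "\<And>x. norm (h' x) \<le> B"
      using Tietze[OF h, of UNIV B] K by (auto simp: compact_imp_closed)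
    have cont: "continuous_on UNIV (\<lambda>t. h' (g t))"
      using continuous_on_compose2[OF h'(1) g(1)] by simp
    have "measure_pmf.expectation (P n) h = (\<integral>t. h' (g t) \<partial>M n)" for n
      unfolding M_int[OF cont] using \<sigma> h'(2) by (intro P_cong) simp
    moreover have "(\<integral>t. h' (g t) \<partial>M0) = (\<integral>x. h x \<partial>\<mu>)"
    proof -
      have "(\<integral>t. h' (g t) \<partial>M0) = (\<integral>x. h' x \<partial>\<nu>)"
        unfolding \<nu>_def using borel_measurable_continuous_onI[OF h'(1)] by (simp add: integral_distr)
      also have "\<dots> = (\<integral>x. h' x \<partial>\<mu>)"
        unfolding \<mu>_def using borel_measurable_continuous_onI[OF h'(1)] K_\<nu>
        by (intro integral_restrict_full[OF full, symmetric]) (auto simp: \<nu>_def)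
      also have "\<dots> = (\<integral>x. h x \<partial>\<mu>)"
        using h'(2) K_\<nu> by (intro Bochner_Integration.integral_cong) (auto simp: \<mu>_def)
      finally show ?thesis .
    qed
    ultimately show "(\<lambda>n. measure_pmf.expectation (P (r n)) h) \<longlonglongrightarrow> (\<integral>x. h x \<partial>\<mu>)"
      using conv[OF cont, of B] h'(3) by simp
  qed
qed

section \<open>Families of continuous functions on a compact set\<close>

text \<open>
  Separability of \<open>C(K)\<close>, in the form needed to replace a family of continuous functions by countably
  many of its members. A function whose oscillation on the scale \<open>1/(n+1)\<close> is below \<open>1/(m+1)\<close> is
  determined up to \<open>3/(m+1)\<close> by its values, rounded to multiples of \<open>1/(m+1)\<close>, on a finite
  \<open>1/(n+1)\<close>-net. There are only countably many such signatures \<open>(n, m, values)\<close>, and one member of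
  the family is picked for each signature that occurs.
\<close>

lemma countable_uniformly_dense_subfamily:
  fixes h :: "'a \<Rightarrow> 'b::metric_space \<Rightarrow> real"
  assumes K: "compact K" and cont: "\<And>x. x \<in> X \<Longrightarrow> continuous_on K (h x)"
  obtains D where "countable D" "D \<subseteq> X"
    "\<And>x e. x \<in> X \<Longrightarrow> 0 < e \<Longrightarrow> \<exists>d\<in>D. \<forall>y\<in>K. \<bar>h x y - h d y\<bar> < e"
proof -
  have "\<exists>L. set L \<subseteq> K \<and> K \<subseteq> (\<Union>z\<in>set L. ball z (1 / real (Suc n)))" for n
  proof -
    have "\<exists>k. finite k \<and> k \<subseteq> K \<and> K \<subseteq> (\<Union>z\<in>k. ball z (1 / real (Suc n)))"
      by (rule compactE_image[OF K, of K "\<lambda>z. ball z (1 / real (Suc n))"]) force+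
    then show ?thesis by (metis finite_list)
  qed
  then obtain L where L: "\<And>n. set (L n) \<subseteq> K"
      "\<And>n. K \<subseteq> (\<Union>z\<in>set (L n). ball z (1 / real (Suc n)))"
    by metis
  define sig where "sig x n m = map (\<lambda>z. \<lfloor>real (Suc m) * h x z\<rfloor>) (L n)" for x n m
  define good where "good x n m \<longleftrightarrow> x \<in> X \<and>
    (\<forall>y\<in>K. \<forall>z\<in>K. dist z y < 1 / real (Suc n) \<longrightarrow> \<bar>h x y - h x z\<bar> < 1 / real (Suc m))" for x n m
  define T where "T = {(n, m, sig x n m) | x n m. good x n m}"
  have "\<forall>s\<in>T. \<exists>x. good x (fst s) (fst (snd s)) \<and> sig x (fst s) (fst (snd s)) = snd (snd s)"
    by (auto simp: T_def)
  then obtain pick where pick: "\<And>s. s \<in> T \<Longrightarrow> good (pick s) (fst s) (fst (snd s)) \<and>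
      sig (pick s) (fst s) (fst (snd s)) = snd (snd s)"
    by metis
  show thesis
  proof
    show "countable (pick ` T)" by simp
    show "pick ` T \<subseteq> X" using pick by (auto simp: good_def)
    fix x and e :: real assume "x \<in> X" "0 < e"
    obtain m where "3 / e < real m" using reals_Archimedean2 by blast
    then have m: "3 / real (Suc m) < e"
      using \<open>0 < e\<close> by (simp add: field_simps)
    have "uniformly_continuous_on K (h x)"
      using compact_uniformly_continuous[OF cont[OF \<open>x \<in> X\<close>] K] .
    then obtain \<delta> where "0 < \<delta>" and \<delta>: "\<And>y z. y \<in> K \<Longrightarrow> z \<in> K \<Longrightarrow> dist z y < \<delta> \<Longrightarrow>
        dist (h x z) (h x y) < 1 / real (Suc m)"
      unfolding uniformly_continuous_on_def by (metis of_nat_0_less_iff zero_less_Suc zero_less_divide_1_iff)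
    obtain n where n: "1 / real (Suc n) < \<delta>"
      using \<open>0 < \<delta>\<close> reals_Archimedean by (metis inverse_eq_divide)
    have good_x: "good x n m"
      unfolding good_def
    proof (intro conjI ballI impI \<open>x \<in> X\<close>)
      fix y z assume "y \<in> K" "z \<in> K" "dist z y < 1 / real (Suc n)"
      then show "\<bar>h x y - h x z\<bar> < 1 / real (Suc m)"
        using \<delta>[of y z] n by (simp add: dist_real_def abs_minus_commute)
    qed
    define d where "d = pick (n, m, sig x n m)"
    have inT: "(n, m, sig x n m) \<in> T" using good_x by (auto simp: T_def)
    have d: "good d n m" "sig d n m = sig x n m"
      using pick[OF inT] by (simp_all add: d_def)
    have "\<bar>h x y - h d y\<bar> < e" if "y \<in> K" for y
    proof -
      obtain z where z: "z \<in> set (L n)" "dist z y < 1 / real (Suc n)"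
        using subsetD[OF L(2)[of n] \<open>y \<in> K\<close>] by (auto simp del: of_nat_Suc)
      have "z \<in> K" using z(1) L(1) by blast
      have "\<lfloor>real (Suc m) * h x z\<rfloor> = \<lfloor>real (Suc m) * h d z\<rfloor>"
        using d(2) z(1) by (auto simp: sig_def)
      then have "\<bar>real (Suc m) * h x z - real (Suc m) * h d z\<bar> < 1"
        by linarith
      then have "real (Suc m) * \<bar>h x z - h d z\<bar> < 1"
        by (simp add: abs_mult right_diff_distrib[symmetric] del: of_nat_Suc)
      then have "\<bar>h x z - h d z\<bar> < 1 / real (Suc m)"
        by (simp add: field_simps del: of_nat_Suc)
      moreover have "\<bar>h x y - h x z\<bar> < 1 / real (Suc m)" "\<bar>h d y - h d z\<bar> < 1 / real (Suc m)"
        using good_x d(1) that \<open>z \<in> K\<close> z(2) by (auto simp: good_def)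
      moreover have "3 / real (Suc m) = 1 / real (Suc m) + 1 / real (Suc m) + 1 / real (Suc m)"
        by simp
      ultimately show ?thesis using m by linarith
    qed
    then show "\<exists>d\<in>pick ` T. \<forall>y\<in>K. \<bar>h x y - h d y\<bar> < e"
      using inT by (intro bexI[of _ d]) (auto simp: d_def)
  qed
qed

text \<open>
  Joint measurability of a Caratheodory function: \<open>f x w\<close> is the limit of \<open>f x (d k)\<close>, where \<open>d k\<close> is the
  first element of a dense sequence within \<open>1/(n+1)\<close> of \<open>w\<close>; for each \<open>n\<close> this expression involves
  only countably many of the measurable functions \<open>\<lambda>x. f x (d k)\<close>.
\<close>

lemma caratheodory_function_measurable:
  fixes f :: "'a \<Rightarrow> 'b::{metric_space, second_countable_topology} \<Rightarrow> real"
  assumes cont: "\<And>x. x \<in> space M \<Longrightarrow> continuous_on K (f x)"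
    and meas: "\<And>w. w \<in> K \<Longrightarrow> (\<lambda>x. f x w) \<in> borel_measurable M"
  shows "(\<lambda>(x, w). f x w) \<in> borel_measurable (M \<Otimes>\<^sub>M restrict_space borel K)"
proof (cases "K = {}")
  case True
  then show ?thesis
    by (intro measurableI) (auto simp: space_pair_measure space_restrict_space)
next
  case False
  obtain D where D: "countable D" "D \<subseteq> K" "K \<subseteq> closure D"
    using separable[of K] by blast
  have "D \<noteq> {}" using False D(3) by auto
  define d where "d = from_nat_into D"
  have dK: "d k \<in> K" for k
    using from_nat_into[OF \<open>D \<noteq> {}\<close>] D(2) by (auto simp: d_def)
  define idx where "idx n w = (LEAST k. dist (d k) w < 1 / real (Suc n))" for n w
  have near: "dist (d (idx n w)) w < 1 / real (Suc n)" if "w \<in> K" for n w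
  proof -
    have "w \<in> closure D" using D(3) that by blast
    then obtain y where "y \<in> D" "dist y w < 1 / real (Suc n)"
      unfolding closure_approachable by (meson of_nat_0_less_iff zero_less_Suc zero_less_divide_1_iff)
    then have "\<exists>k. dist (d k) w < 1 / real (Suc n)"
      using D(1) by (metis d_def from_nat_into_surj)
    then show ?thesis unfolding idx_def by (rule LeastI_ex)
  qed
  have idx_meas: "idx n \<in> measurable (restrict_space borel K) (count_space UNIV)" for n
    unfolding idx_def
  proof (rule measurable_Least)
    fix k
    have "Measurable.pred borel (\<lambda>w. dist (d k) w < 1 / real (Suc n))" by measurable
    then show "Measurable.pred (restrict_space borel K) (\<lambda>w. dist (d k) w < 1 / real (Suc n))"
      by (rule measurable_restrict_space1)
  qed
  have approx_meas: "(\<lambda>z. f (fst z) (d (idx n (snd z)))) \<in> borel_measurable (M \<Otimes>\<^sub>M restrict_space borel K)"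
    for n
    using measurable_compose[OF measurable_fst meas[OF dK]] measurable_compose[OF measurable_snd idx_meas]
    by (rule measurable_compose_countable)
  show ?thesis
  proof (rule borel_measurable_LIMSEQ_real[OF _ approx_meas])
    fix z assume "z \<in> space (M \<Otimes>\<^sub>M restrict_space borel K)"
    then have z: "fst z \<in> space M" "snd z \<in> K"
      by (auto simp: space_pair_measure space_restrict_space)
    have "(\<lambda>n. d (idx n (snd z))) \<longlonglongrightarrow> snd z"
    proof (rule metric_tendsto_imp_tendsto[OF LIMSEQ_inverse_real_of_nat])
      show "\<forall>\<^sub>F n in sequentially. dist (d (idx n (snd z))) (snd z) \<le> dist (inverse (real (Suc n))) 0"
        using near[OF z(2)] by (intro always_eventually allI) (simp add: inverse_eq_divide less_imp_le)
    qed
    then have "(\<lambda>n. f (fst z) (d (idx n (snd z)))) \<longlonglongrightarrow> f (fst z) (snd z)"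
      by (rule continuous_on_tendsto_compose[OF cont[OF z(1)]]) (use z(2) dK in auto)
    then show "(\<lambda>n. f (fst z) (d (idx n (snd z)))) \<longlonglongrightarrow> (case z of (x, w) \<Rightarrow> f x w)"
      by (simp add: case_prod_beta)
  qed
qed

section \<open>Minimax duality for designs\<close>

lemma continuous_integrable_prob_measures:
  fixes h :: "'b::topological_space \<Rightarrow> real"
  assumes \<mu>: "\<mu> \<in> prob_measures A" and K: "compact K" "A \<subseteq> K" and h: "continuous_on K h"
  shows "integrable \<mu> h"
proof -
  interpret prob_space \<mu> using \<mu> by (simp add: prob_measures_def)
  have sets_eq: "sets \<mu> = sets (restrict_space borel A)"
    using \<mu> by (simp add: prob_measures_def)
  have "bounded (h ` K)"
    using compact_continuous_image[OF h K(1)] compact_imp_bounded by blast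
  then obtain B where "\<And>w. w \<in> K \<Longrightarrow> norm (h w) \<le> B"
    by (auto simp: bounded_iff)
  moreover have "space \<mu> = A"
    using sets_eq_imp_space_eq[OF sets_eq] by (simp add: space_restrict_space)
  moreover have "h \<in> borel_measurable \<mu>"
    using borel_measurable_continuous_on_restrict[OF continuous_on_subset[OF h K(2)]]
    by (simp cong: measurable_cong_sets add: sets_eq)
  ultimately show ?thesis
    using K(2) by (intro integrable_const_bound[of _ B]) auto
qed

text \<open>
  Mixed strategies \<open>Q n\<close> that meet the first \<open>n\<close> constraints of a uniformly dense sequence up to
  \<open>2/(n+1)\<close> have a weakly convergent subsequence. Each constraint is the integral of a
  continuous function, hence passes to the limit; the remaining constraints follow by uniform
  approximation.
\<close>

lemma dual_measure_exists:
  fixes f :: "'a \<Rightarrow> 'b::euclidean_space \<Rightarrow> real"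
  assumes K: "compact K" and "X \<noteq> {}" and cont: "\<And>x. x \<in> X \<Longrightarrow> continuous_on K (f x)"
    and primal: "\<And>p e. finite (set_pmf p) \<Longrightarrow> set_pmf p \<subseteq> X \<Longrightarrow> 0 < e \<Longrightarrow>
      \<exists>w\<in>K. measure_pmf.expectation p (\<lambda>x. f x w) \<le> c + e"
  shows "\<exists>\<mu>\<in>prob_measures K. \<forall>x\<in>X. (\<integral>w. f x w \<partial>\<mu>) \<le> c"
proof -
  have "K \<noteq> {}"
    using primal[of "return_pmf (SOME x. x \<in> X)" 1] \<open>X \<noteq> {}\<close> by (auto simp: some_in_eq)
  obtain D where D: "countable D" "D \<subseteq> X"
      "\<And>x e. x \<in> X \<Longrightarrow> 0 < e \<Longrightarrow> \<exists>d\<in>D. \<forall>w\<in>K. \<bar>f x w - f d w\<bar> < e"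
    using countable_uniformly_dense_subfamily[where h = f and X = X, OF K] cont by metis
  have "D \<noteq> {}" using D(3)[of _ 1] \<open>X \<noteq> {}\<close> by fastforce
  define d where "d = from_nat_into D"
  have dX: "d k \<in> X" for k
    using from_nat_into[OF \<open>D \<noteq> {}\<close>] D(2) by (auto simp: d_def)
  have "\<exists>q. set_pmf q \<subseteq> K \<and> (\<forall>x\<in>d ` {..n}. measure_pmf.expectation q (f x) \<le> (c + 1 / Suc n) + 1 / Suc n)"
    for n :: nat
  proof (rule dual_pmf_for_finitely_many_constraints)
    fix p assume p: "set_pmf p \<subseteq> d ` {..n}"
    then have "finite (set_pmf p)" "set_pmf p \<subseteq> X"
      using dX by (auto intro: finite_subset)
    then show "\<exists>w\<in>K. measure_pmf.expectation p (\<lambda>x. f x w) \<le> c + 1 / Suc n"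
      by (intro primal) auto
  qed (use \<open>K \<noteq> {}\<close> in auto)
  then obtain Q where Q: "\<And>n. set_pmf (Q n) \<subseteq> K"
    "\<And>n k. k \<le> n \<Longrightarrow> measure_pmf.expectation (Q n) (f (d k)) \<le> (c + 1 / Suc n) + 1 / Suc n"
    by (metis atMost_iff imageI)
  obtain \<mu> r where r: "strict_mono (r :: nat \<Rightarrow> nat)" and \<mu>: "\<mu> \<in> prob_measures K"
    and lim: "\<And>h :: 'b \<Rightarrow> real. continuous_on K h \<Longrightarrow>
       (\<lambda>n. measure_pmf.expectation (Q (r n)) h) \<longlonglongrightarrow> (\<integral>w. h w \<partial>\<mu>)"
    using pmf_on_compact_weakly_convergent_subseq[of K Q] K Q(1) by metis
  interpret prob_space \<mu> using \<mu> by (simp add: prob_measures_def)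
  have dense: "(\<integral>w. f (d k) w \<partial>\<mu>) \<le> c" for k
  proof (rule LIMSEQ_le[OF lim[OF cont[OF dX]]])
    have "(\<lambda>n. (c + 1 / Suc n) + 1 / Suc n) \<longlonglongrightarrow> c"
      using tendsto_add[OF tendsto_add[OF tendsto_const lim_inverse_n'] lim_inverse_n']
      by (subst filterlim_sequentially_Suc) simp
    from LIMSEQ_subseq_LIMSEQ[OF this r]
    show "(\<lambda>n. (c + 1 / Suc (r n)) + 1 / Suc (r n)) \<longlonglongrightarrow> c" by (simp add: o_def)
    have "k \<le> r n" if "k \<le> n" for n
      using seq_suble[OF r, of n] that by linarith
    then show "\<exists>N. \<forall>n\<ge>N. measure_pmf.expectation (Q (r n)) (f (d k)) \<le> (c + 1 / Suc (r n)) + 1 / Suc (r n)"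
      using Q(2) by blast
  qed
  have "(\<integral>w. f x w \<partial>\<mu>) \<le> c" if "x \<in> X" for x
  proof (rule field_le_epsilon)
    fix e :: real assume "0 < e"
    then obtain y where y: "y \<in> D" "\<And>w. w \<in> K \<Longrightarrow> \<bar>f x w - f y w\<bar> < e"
      using D(3)[OF \<open>x \<in> X\<close>] by blast
    then obtain k where k: "y = d k"
      using from_nat_into_surj[OF D(1)] by (metis d_def)
    have space: "space \<mu> = K"
      using \<mu> sets_eq_imp_space_eq[of \<mu> "restrict_space borel K"]
      by (simp add: prob_measures_def space_restrict_space)
    have int: "integrable \<mu> (f z)" if "z \<in> X" for z
      using continuous_integrable_prob_measures[OF \<mu> K subset_refl cont[OF that]] .
    have "(\<integral>w. f x w \<partial>\<mu>) \<le> (\<integral>w. f (d k) w + e \<partial>\<mu>)"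
      using y(2) by (intro integral_mono int dX \<open>x \<in> X\<close> Bochner_Integration.integrable_add)
        (fastforce simp: space k)+
    also have "\<dots> = (\<integral>w. f (d k) w \<partial>\<mu>) + e"
      using int[OF dX] by (simp add: prob_space)
    finally show "(\<integral>w. f x w \<partial>\<mu>) \<le> c + e" using dense[of k] by linarith
  qed
  then show ?thesis using \<mu> by blast
qed

lemma prob_measuresD:
  assumes "\<mu> \<in> prob_measures A"
  shows "prob_space \<mu>" "sets \<mu> = sets (restrict_space borel A)" "space \<mu> = A"
  using assms sets_eq_imp_space_eq[of \<mu> "restrict_space borel A"]
  by (auto simp: prob_measures_def space_restrict_space)

text \<open>
  A discrete distribution as a Borel measure on \<open>X\<close>. The map \<open>\<tau>\<close> is the identity on the support of \<open>p\<close>;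
  it sends the other points into \<open>X\<close>, because \<open>measure_pmf p\<close> lives on the whole type.
\<close>

lemma finite_design_of_pmf:
  fixes X :: "'a::topological_space set"
  assumes "set_pmf p \<subseteq> X"
  obtains \<nu> where "\<nu> \<in> prob_measures X"
    "\<And>h :: 'a \<Rightarrow> real. h \<in> borel_measurable \<nu> \<Longrightarrow> (\<integral>x. h x \<partial>\<nu>) = measure_pmf.expectation p h"
proof -
  obtain x0 where "x0 \<in> X" using assms set_pmf_not_empty[of p] by blast
  define \<tau> where "\<tau> x = (if x \<in> X then x else x0)" for x
  define \<nu> where "\<nu> = distr (measure_pmf p) (restrict_space borel X) \<tau>"
  have \<tau>: "\<tau> \<in> measurable (measure_pmf p) (restrict_space borel X)"
    using \<open>x0 \<in> X\<close> by (auto simp: \<tau>_def space_restrict_space)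
  have "\<nu> \<in> prob_measures X"
    using measure_pmf.prob_space_distr[OF \<tau>] by (simp add: prob_measures_def \<nu>_def)
  moreover have "(\<integral>x. h x \<partial>\<nu>) = measure_pmf.expectation p h" if "h \<in> borel_measurable \<nu>" for h :: "'a \<Rightarrow> real"
  proof -
    have "(\<integral>x. h x \<partial>\<nu>) = measure_pmf.expectation p (\<lambda>x. h (\<tau> x))"
      using that unfolding \<nu>_def by (intro integral_distr \<tau>) simp
    also have "\<dots> = measure_pmf.expectation p h"
      using assms by (intro integral_cong_AE) (auto simp: AE_measure_pmf_iff \<tau>_def)
    finally show ?thesis .
  qed
  ultimately show thesis using that by blast
qed

text \<open>
  The game behind the criterion. A design \<open>\<nu>\<close> on \<open>X\<close> is paid the mean of \<open>f x w\<close>, where \<open>w \<in> K\<close> is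
  nature's choice. The two sides enter asymmetrically: \<open>f\<close> is continuous in \<open>w\<close> on a compact set,
  while in \<open>x\<close> it is merely integrable for every design. In particular \<open>payoff \<nu>\<close> is in general
  only lower semicontinuous.
\<close>

locale design_game =
  fixes X :: "'a::topological_space set" and K :: "'b::euclidean_space set"
    and f :: "'a \<Rightarrow> 'b \<Rightarrow> real"
  assumes K: "compact K" "K \<noteq> {}"
    and cont: "x \<in> X \<Longrightarrow> continuous_on K (f x)"
    and nonneg: "x \<in> X \<Longrightarrow> w \<in> K \<Longrightarrow> 0 \<le> f x w"
    and integrable_design: "\<nu> \<in> prob_measures X \<Longrightarrow> w \<in> K \<Longrightarrow> integrable \<nu> (\<lambda>x. f x w)"
begin

definition payoff :: "'a measure \<Rightarrow> 'b \<Rightarrow> real" where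
  "payoff \<nu> w = (\<integral>x. f x w \<partial>\<nu>)"

definition worst_case :: "'a measure \<Rightarrow> real" where
  "worst_case \<nu> = (INF w\<in>K. payoff \<nu> w)"

definition minimisers :: "'a measure \<Rightarrow> 'b set" where
  "minimisers \<nu> = {w\<in>K. payoff \<nu> w = worst_case \<nu>}"

lemma payoff_nonneg: "\<nu> \<in> prob_measures X \<Longrightarrow> w \<in> K \<Longrightarrow> 0 \<le> payoff \<nu> w"
  unfolding payoff_def by (intro Bochner_Integration.integral_nonneg) (auto simp: prob_measuresD nonneg)

lemma worst_case_le: "\<nu> \<in> prob_measures X \<Longrightarrow> w \<in> K \<Longrightarrow> worst_case \<nu> \<le> payoff \<nu> w"
  unfolding worst_case_def by (intro cINF_lower bdd_belowI2[of _ 0] payoff_nonneg)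

lemma worst_case_nonneg: "\<nu> \<in> prob_measures X \<Longrightarrow> 0 \<le> worst_case \<nu>"
  unfolding worst_case_def by (intro cINF_greatest K payoff_nonneg)

text \<open>
  Fubini for a design and a mixed strategy of nature. The nonnegative integral is used because
  \<open>payoff \<nu>\<close> may be unbounded on \<open>K\<close>, so that its integrability under \<open>\<mu>\<close> is not known beforehand.
\<close>

lemma mixed_payoff_interchange:
  assumes \<nu>: "\<nu> \<in> prob_measures X" and \<mu>: "\<mu> \<in> prob_measures A" and "A \<subseteq> K"
  shows "payoff \<nu> \<in> borel_measurable \<mu>"
    and "(\<lambda>x. \<integral>w. f x w \<partial>\<mu>) \<in> borel_measurable \<nu>"
    and "(\<integral>\<^sup>+w. ennreal (payoff \<nu> w) \<partial>\<mu>) = (\<integral>\<^sup>+x. ennreal (\<integral>w. f x w \<partial>\<mu>) \<partial>\<nu>)"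
proof -
  note \<nu>' = prob_measuresD[OF \<nu>] and \<mu>' = prob_measuresD[OF \<mu>]
  interpret \<nu>: prob_space \<nu> by fact
  interpret \<mu>: prob_space \<mu> by fact
  interpret pair_sigma_finite \<nu> \<mu> by unfold_locales
  have joint[measurable]: "(\<lambda>(x, w). f x w) \<in> borel_measurable (\<nu> \<Otimes>\<^sub>M \<mu>)"
  proof -
    have "(\<lambda>(x, w). f x w) \<in> borel_measurable (\<nu> \<Otimes>\<^sub>M restrict_space borel A)"
      using \<nu>' \<open>A \<subseteq> K\<close> integrable_design[OF \<nu>]
      by (intro caratheodory_function_measurable) (auto intro: continuous_on_subset[OF cont])
    then show ?thesis
      by (simp cong: measurable_cong_sets sets_pair_measure_cong add: \<mu>'(2))
  qed
  have joint'[measurable]: "(\<lambda>(w, x). f x w) \<in> borel_measurable (\<mu> \<Otimes>\<^sub>M \<nu>)"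
    by measurable
  show "payoff \<nu> \<in> borel_measurable \<mu>"
    unfolding payoff_def[abs_def] by measurable
  show "(\<lambda>x. \<integral>w. f x w \<partial>\<mu>) \<in> borel_measurable \<nu>"
    by measurable
  have "(\<integral>\<^sup>+w. ennreal (payoff \<nu> w) \<partial>\<mu>) = (\<integral>\<^sup>+w. (\<integral>\<^sup>+x. ennreal (f x w) \<partial>\<nu>) \<partial>\<mu>)"
    unfolding payoff_def using \<nu>' \<mu>' \<open>A \<subseteq> K\<close> nonneg integrable_design[OF \<nu>]
    by (intro nn_integral_cong nn_integral_eq_integral[symmetric]) auto
  also have "\<dots> = (\<integral>\<^sup>+x. (\<integral>\<^sup>+w. ennreal (f x w) \<partial>\<mu>) \<partial>\<nu>)"
    using Fubini[of "\<lambda>(x, w). ennreal (f x w)"] by simp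
  also have "\<dots> = (\<integral>\<^sup>+x. ennreal (\<integral>w. f x w \<partial>\<mu>) \<partial>\<nu>)"
  proof (intro nn_integral_cong nn_integral_eq_integral)
    fix x assume x: "x \<in> space \<nu>"
    show "integrable \<mu> (f x)"
      using continuous_integrable_prob_measures[OF \<mu> K(1) \<open>A \<subseteq> K\<close>] cont x \<nu>'(3) by blast
    show "AE w in \<mu>. 0 \<le> f x w"
      using nonneg x \<nu>'(3) \<mu>'(3) \<open>A \<subseteq> K\<close> by auto
  qed
  finally show "(\<integral>\<^sup>+w. ennreal (payoff \<nu> w) \<partial>\<mu>) = (\<integral>\<^sup>+x. ennreal (\<integral>w. f x w \<partial>\<mu>) \<partial>\<nu>)" .
qed

text \<open>
  Weak duality: the worst case of a design is at most its mean payoff against \<open>\<mu>\<close>.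
\<close>

lemma dual_bound_imp_worst_case_le:
  assumes \<nu>: "\<nu> \<in> prob_measures X" and \<mu>: "\<mu> \<in> prob_measures A" and "A \<subseteq> K"
    and "0 \<le> c" and bound: "\<And>x. x \<in> X \<Longrightarrow> (\<integral>w. f x w \<partial>\<mu>) \<le> c"
  shows "worst_case \<nu> \<le> c"
proof -
  note \<nu>' = prob_measuresD[OF \<nu>] and \<mu>' = prob_measuresD[OF \<mu>]
  interpret \<nu>: prob_space \<nu> by fact
  interpret \<mu>: prob_space \<mu> by fact
  have "ennreal (worst_case \<nu>) = (\<integral>\<^sup>+w. ennreal (worst_case \<nu>) \<partial>\<mu>)"
    by (simp add: \<mu>.emeasure_space_1)
  also have "\<dots> \<le> (\<integral>\<^sup>+w. ennreal (payoff \<nu> w) \<partial>\<mu>)"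
    using worst_case_le[OF \<nu>] \<mu>'(3) \<open>A \<subseteq> K\<close> by (intro nn_integral_mono ennreal_leI) auto
  also have "\<dots> = (\<integral>\<^sup>+x. ennreal (\<integral>w. f x w \<partial>\<mu>) \<partial>\<nu>)"
    by (rule mixed_payoff_interchange(3)[OF \<nu> \<mu> \<open>A \<subseteq> K\<close>])
  also have "\<dots> \<le> (\<integral>\<^sup>+x. ennreal c \<partial>\<nu>)"
    using bound \<nu>'(3) by (intro nn_integral_mono ennreal_leI) auto
  also have "\<dots> = ennreal c"
    by (simp add: \<nu>.emeasure_space_1)
  finally show ?thesis using \<open>0 \<le> c\<close> by simp
qed

text \<open>
  Strong duality. Optimality of \<open>\<xi>\<close> is applied to the finitely supported designs: each of them has
  worst case at most that of \<open>\<xi>\<close>, which is the primal hypothesis of the minimax argument.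
\<close>

lemma dual_measure_of_optimal_design:
  assumes \<xi>: "\<xi> \<in> prob_measures X"
    and opt: "\<And>\<nu>. \<nu> \<in> prob_measures X \<Longrightarrow> worst_case \<nu> \<le> worst_case \<xi>"
  shows "\<exists>\<mu>\<in>prob_measures K. \<forall>x\<in>X. (\<integral>w. f x w \<partial>\<mu>) \<le> worst_case \<xi>"
proof (rule dual_measure_exists[OF K(1) _ cont])
  show "X \<noteq> {}"
    using prob_measuresD[OF \<xi>] prob_space.not_empty by metis
  fix p and e :: real assume "set_pmf p \<subseteq> X" "0 < e"
  obtain \<nu> where \<nu>: "\<nu> \<in> prob_measures X"
    "\<And>h :: 'a \<Rightarrow> real. h \<in> borel_measurable \<nu> \<Longrightarrow> (\<integral>x. h x \<partial>\<nu>) = measure_pmf.expectation p h"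
    using finite_design_of_pmf[OF \<open>set_pmf p \<subseteq> X\<close>] by blast
  have "worst_case \<nu> < worst_case \<xi> + e"
    using opt[OF \<nu>(1)] \<open>0 < e\<close> by simp
  then obtain w where w: "w \<in> K" "payoff \<nu> w < worst_case \<xi> + e"
    using cInf_lessD[of "payoff \<nu> ` K"] K(2) unfolding worst_case_def[of \<nu>] by blast
  have "payoff \<nu> w = measure_pmf.expectation p (\<lambda>x. f x w)"
    unfolding payoff_def using integrable_design[OF \<nu>(1) w(1)] by (intro \<nu>(2)) simp
  then show "\<exists>w\<in>K. measure_pmf.expectation p (\<lambda>x. f x w) \<le> worst_case \<xi> + e"
    using w by (intro bexI[of _ w]) auto
qed

text \<open>
  The mean payoff of \<open>\<xi>\<close> against \<open>\<mu>\<close> can be integrated in either order. One order bounds it from below by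
  \<open>worst_case \<xi>\<close>, the other from above by the same number. Hence both integrands agree with this
  number almost everywhere.
\<close>

lemma dual_measure_complementary_slackness:
  assumes \<xi>: "\<xi> \<in> prob_measures X" and \<mu>: "\<mu> \<in> prob_measures K"
    and bound: "\<And>x. x \<in> X \<Longrightarrow> (\<integral>w. f x w \<partial>\<mu>) \<le> worst_case \<xi>"
  shows "AE w in \<mu>. payoff \<xi> w = worst_case \<xi>"
    and "\<exists>x\<in>X. (\<integral>w. f x w \<partial>\<mu>) = worst_case \<xi>"
proof -
  note \<xi>' = prob_measuresD[OF \<xi>] and \<mu>' = prob_measuresD[OF \<mu>]
  interpret \<xi>: prob_space \<xi> by fact
  interpret \<mu>: prob_space \<mu> by fact
  let ?c = "worst_case \<xi>"
  define F where "F x = (\<integral>w. f x w \<partial>\<mu>)" for x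
  note meas = mixed_payoff_interchange(1,2)[OF \<xi> \<mu> subset_refl, folded F_def]
  have exchange: "(\<integral>\<^sup>+w. ennreal (payoff \<xi> w) \<partial>\<mu>) = (\<integral>\<^sup>+x. ennreal (F x) \<partial>\<xi>)"
    unfolding F_def by (rule mixed_payoff_interchange(3)[OF \<xi> \<mu> subset_refl])
  have F: "0 \<le> F x" "F x \<le> ?c" if "x \<in> X" for x
    using bound that nonneg \<mu>'(3) by (auto simp: F_def intro!: Bochner_Integration.integral_nonneg)
  have "integrable \<xi> F"
    using F \<xi>'(3) meas(2) by (intro \<xi>.integrable_const_bound[of _ ?c]) auto
  then have F_int: "(\<integral>\<^sup>+x. ennreal (F x) \<partial>\<xi>) = ennreal (\<integral>x. F x \<partial>\<xi>)"
    using F \<xi>'(3) by (intro nn_integral_eq_integral) auto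
  have payoff_int: "integrable \<mu> (payoff \<xi>)"
    using meas(1) payoff_nonneg[OF \<xi>] \<mu>'(3) by (intro integrableI_nonneg) (auto simp: exchange F_int)
  have "(\<integral>\<^sup>+w. ennreal (payoff \<xi> w) \<partial>\<mu>) = ennreal (\<integral>w. payoff \<xi> w \<partial>\<mu>)"
    using payoff_nonneg[OF \<xi>] \<mu>'(3) by (intro nn_integral_eq_integral payoff_int) auto
  then have same: "(\<integral>w. payoff \<xi> w \<partial>\<mu>) = (\<integral>x. F x \<partial>\<xi>)"
    using F \<xi>'(3) payoff_nonneg[OF \<xi>] \<mu>'(3) unfolding exchange F_int
    by (subst (asm) ennreal_inj) (auto intro!: Bochner_Integration.integral_nonneg)
  have "(\<integral>x. F x \<partial>\<xi>) \<le> (\<integral>x. ?c \<partial>\<xi>)"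
    using F \<xi>'(3) \<open>integrable \<xi> F\<close> by (intro integral_mono) auto
  moreover have "(\<integral>w. ?c \<partial>\<mu>) \<le> (\<integral>w. payoff \<xi> w \<partial>\<mu>)"
    using worst_case_le[OF \<xi>] \<mu>'(3) payoff_int by (intro integral_mono) auto
  ultimately have eq: "(\<integral>x. F x \<partial>\<xi>) = ?c" "(\<integral>w. payoff \<xi> w \<partial>\<mu>) = ?c"
    using same by (simp_all add: \<xi>.prob_space \<mu>.prob_space)
  have "(\<integral>w. payoff \<xi> w - ?c \<partial>\<mu>) = 0"
    using payoff_int eq(2) by (simp add: \<mu>.prob_space)
  then have "AE w in \<mu>. payoff \<xi> w - ?c = 0"
    using worst_case_le[OF \<xi>] \<mu>'(3) payoff_int by (subst (asm) integral_nonneg_eq_0_iff_AE) auto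
  then show "AE w in \<mu>. payoff \<xi> w = ?c" by simp
  have "(\<integral>x. ?c - F x \<partial>\<xi>) = 0"
    using \<open>integrable \<xi> F\<close> eq(1) by (simp add: \<xi>.prob_space)
  then have "AE x in \<xi>. ?c - F x = 0"
    using F \<xi>'(3) \<open>integrable \<xi> F\<close> by (subst (asm) integral_nonneg_eq_0_iff_AE) auto
  then have "AE x in \<xi>. x \<in> X \<and> F x = ?c"
    using AE_space \<xi>'(3) by (auto elim: AE_mp)
  then show "\<exists>x\<in>X. (\<integral>w. f x w \<partial>\<mu>) = ?c"
    using eventually_happens'[OF \<xi>.ae_filter_bot] unfolding F_def by blast
qed

theorem optimal_design_iff_dual_measure:
  assumes \<xi>: "\<xi> \<in> prob_measures X"
  shows "(\<forall>\<nu>\<in>prob_measures X. worst_case \<nu> \<le> worst_case \<xi>) \<longleftrightarrow>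
    (\<exists>\<mu>\<in>prob_measures (minimisers \<xi>). (\<forall>x\<in>X. (\<integral>w. f x w \<partial>\<mu>) \<le> worst_case \<xi>) \<and>
       (\<exists>x\<in>X. (\<integral>w. f x w \<partial>\<mu>) = worst_case \<xi>))"
proof
  assume "\<forall>\<nu>\<in>prob_measures X. worst_case \<nu> \<le> worst_case \<xi>"
  then obtain \<mu> where \<mu>: "\<mu> \<in> prob_measures K" and
    bound: "\<And>x. x \<in> X \<Longrightarrow> (\<integral>w. f x w \<partial>\<mu>) \<le> worst_case \<xi>"
    using dual_measure_of_optimal_design[OF \<xi>] by blast
  note slack = dual_measure_complementary_slackness[OF \<xi> \<mu> bound]
  have sub: "minimisers \<xi> \<subseteq> K" by (auto simp: minimisers_def)
  have "{w \<in> space \<mu>. payoff \<xi> w = worst_case \<xi>} \<in> sets \<mu>"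
    using mixed_payoff_interchange(1)[OF \<xi> \<mu> subset_refl] by measurable
  then have in_sets: "minimisers \<xi> \<in> sets \<mu>"
    by (simp add: minimisers_def prob_measuresD[OF \<mu>])
  have full: "AE w in \<mu>. w \<in> minimisers \<xi>"
    using slack(1) AE_space by (auto simp: minimisers_def prob_measuresD[OF \<mu>] elim: AE_mp)
  have same: "(\<integral>w. f x w \<partial>restrict_space \<mu> (minimisers \<xi>)) = (\<integral>w. f x w \<partial>\<mu>)" if "x \<in> X" for x
    using continuous_integrable_prob_measures[OF \<mu> K(1) subset_refl cont[OF that]]
    by (intro integral_restrict_full[OF \<mu> sub in_sets full]) simp
  show "\<exists>\<mu>\<in>prob_measures (minimisers \<xi>). (\<forall>x\<in>X. (\<integral>w. f x w \<partial>\<mu>) \<le> worst_case \<xi>) \<and>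
       (\<exists>x\<in>X. (\<integral>w. f x w \<partial>\<mu>) = worst_case \<xi>)"
    using restrict_in_prob_measures[OF \<mu> sub in_sets full] slack(2) bound
    by (intro bexI[of _ "restrict_space \<mu> (minimisers \<xi>)"]) (auto simp: same)
next
  assume "\<exists>\<mu>\<in>prob_measures (minimisers \<xi>). (\<forall>x\<in>X. (\<integral>w. f x w \<partial>\<mu>) \<le> worst_case \<xi>) \<and>
       (\<exists>x\<in>X. (\<integral>w. f x w \<partial>\<mu>) = worst_case \<xi>)"
  then show "\<forall>\<nu>\<in>prob_measures X. worst_case \<nu> \<le> worst_case \<xi>"
    using worst_case_nonneg[OF \<xi>]
    by (auto intro!: dual_bound_imp_worst_case_le[where A = "minimisers \<xi>"] simp: minimisers_def)
qed

end

section \<open>Extended E-optimality\<close>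

text \<open>
  The quotient whose square has mean \<open>H\<^sub>E\<close>, extended to the directions at \<open>\<theta>0\<close>.
\<close>

definition response_quotient ::
    "('x \<Rightarrow> 'p::real_normed_vector \<Rightarrow> real) \<Rightarrow> 'p set \<Rightarrow> 'p \<Rightarrow> 'x \<Rightarrow> 'p \<times> 'p \<Rightarrow> real" where
  "response_quotient \<eta> \<Theta> \<theta>0 x = (\<lambda>(\<theta>, u).
     if \<theta> \<noteq> \<theta>0 then (\<eta> x \<theta> - \<eta> x \<theta>0) / norm (\<theta> - \<theta>0)
     else directional_response \<eta> \<Theta> \<theta>0 u x)"

lemma directed_points_subset:
  assumes "closed \<Theta>"
  shows "directed_points \<Theta> \<theta>0 \<subseteq> \<Theta> \<times> cball 0 1"
  unfolding directed_points_def
proof (rule closure_minimal)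
  show "(\<lambda>\<theta>. (\<theta>, sgn (\<theta> - \<theta>0))) ` (\<Theta> - {\<theta>0}) \<subseteq> \<Theta> \<times> cball 0 1"
    by (intro image_subsetI) (simp add: norm_sgn)
  show "closed (\<Theta> \<times> cball 0 1)"
    by (intro closed_Times assms closed_cball)
qed

lemma compact_directed_points:
  fixes \<Theta> :: "'p::euclidean_space set"
  assumes "compact \<Theta>"
  shows "compact (directed_points \<Theta> \<theta>0)"
proof -
  have "compact (\<Theta> \<times> cball (0::'p) 1)"
    using assms by (intro compact_Times compact_cball)
  moreover have "closed (directed_points \<Theta> \<theta>0)"
    by (simp add: directed_points_def)
  ultimately have "compact (\<Theta> \<times> cball 0 1 \<inter> directed_points \<Theta> \<theta>0)"
    by (rule compact_Int_closed)
  then show ?thesis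
    using directed_points_subset[OF compact_imp_closed[OF assms], of \<theta>0] by (simp add: Int_absorb1)
qed

lemma directed_points_nonempty:
  fixes \<Theta> :: "'p::{real_normed_vector, perfect_space} set"
  assumes "\<Theta> \<subseteq> closure (interior \<Theta>)" "\<theta>0 \<in> \<Theta>"
  shows "directed_points \<Theta> \<theta>0 \<noteq> {}"
proof
  assume "directed_points \<Theta> \<theta>0 = {}"
  then have "\<Theta> = {\<theta>0}"
    using assms(2) by (auto simp: directed_points_def)
  then show False
    using assms by (simp add: interior_singleton)
qed

text \<open>
  Both branches of the quotient are given by the one formula \<open>D u + \<rho> \<theta>\<close>, where \<open>D\<close> is the derivative at
  \<open>\<theta>0\<close> and \<open>\<rho>\<close> is the remainder divided by \<open>norm (\<theta> - \<theta>0)\<close>: away from \<open>\<theta>0\<close> because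
  \<open>u = sgn (\<theta> - \<theta>0)\<close>, and at \<open>\<theta>0\<close> because \<open>\<rho> \<theta>0 = 0\<close>. Differentiability at \<open>\<theta>0\<close> is continuity of \<open>\<rho>\<close>
  there.
\<close>

lemma response_quotient_continuous:
  fixes \<Theta> :: "'p::real_normed_vector set"
  assumes "closed \<Theta>" and \<eta>: "continuous_on \<Theta> (\<eta> x)" and diff: "\<eta> x differentiable (at \<theta>0 within \<Theta>)"
  shows "continuous_on (directed_points \<Theta> \<theta>0) (response_quotient \<eta> \<Theta> \<theta>0 x)"
proof -
  define D where "D = frechet_derivative (\<eta> x) (at \<theta>0 within \<Theta>)"
  have D: "(\<eta> x has_derivative D) (at \<theta>0 within \<Theta>)"
    using diff by (simp add: D_def frechet_derivative_works)
  interpret D: bounded_linear D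
    using D by (rule has_derivative_bounded_linear)
  \<comment> \<open>At \<open>\<theta>0\<close> the formula reads \<open>inverse 0 *\<^sub>R 0\<close>, which is 0.\<close>
  define \<rho> where "\<rho> t = (\<eta> x t - \<eta> x \<theta>0 - D (t - \<theta>0)) /\<^sub>R norm (t - \<theta>0)" for t
  have "continuous_on \<Theta> \<rho>"
    unfolding continuous_on_def
  proof
    fix t assume "t \<in> \<Theta>"
    show "(\<rho> \<longlongrightarrow> \<rho> t) (at t within \<Theta>)"
    proof (cases "t = \<theta>0")
      case True
      then show ?thesis
        using D by (simp add: has_derivative_at_within \<rho>_def[abs_def])
    next
      case False
      have "(\<eta> x \<longlongrightarrow> \<eta> x t) (at t within \<Theta>)"
        using \<eta> \<open>t \<in> \<Theta>\<close> by (simp add: continuous_on_def)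
      then show ?thesis
        unfolding \<rho>_def by (intro tendsto_intros D.tendsto) (use False in simp_all)
    qed
  qed
  moreover have "fst ` directed_points \<Theta> \<theta>0 \<subseteq> \<Theta>"
    using directed_points_subset[OF \<open>closed \<Theta>\<close>, of \<theta>0] by auto
  ultimately have "continuous_on (directed_points \<Theta> \<theta>0) (\<lambda>\<omega>. \<rho> (fst \<omega>))"
    by (rule continuous_on_compose2[OF _ continuous_on_fst[OF continuous_on_id]])
  then have "continuous_on (directed_points \<Theta> \<theta>0) (\<lambda>\<omega>. D (snd \<omega>) + \<rho> (fst \<omega>))"
    by (intro continuous_on_add D.continuous_on continuous_on_snd continuous_on_id)
  moreover have "response_quotient \<eta> \<Theta> \<theta>0 x \<omega> = D (snd \<omega>) + \<rho> (fst \<omega>)"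
    if \<omega>: "\<omega> \<in> directed_points \<Theta> \<theta>0" for \<omega>
  proof -
    obtain t u where tu: "\<omega> = (t, u)" by fastforce
    show ?thesis
    proof (cases "t = \<theta>0")
      case True
      then show ?thesis
        by (simp add: tu response_quotient_def directional_response_def D_def \<rho>_def)
    next
      case False
      then have "u = sgn (t - \<theta>0)"
        using \<omega> directed_points_off_center[OF \<open>closed \<Theta>\<close>] by (simp add: tu)
      then have "D u = D (t - \<theta>0) / norm (t - \<theta>0)"
        by (simp only: sgn_div_norm D.scaleR real_scaleR_def divide_inverse mult.commute)
      moreover have "\<rho> t = (\<eta> x t - \<eta> x \<theta>0) / norm (t - \<theta>0) - D (t - \<theta>0) / norm (t - \<theta>0)"
        by (simp only: \<rho>_def real_scaleR_def diff_divide_distrib divide_inverse right_diff_distrib mult.commute)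
      ultimately show ?thesis
        using False by (simp add: tu response_quotient_def)
    qed
  qed
  ultimately show ?thesis
    by (subst continuous_on_cong[OF refl])
qed

lemma H_E_eq_integral: "H_E \<eta> \<Theta> \<theta>0 \<xi> \<omega> = (\<integral>x. (response_quotient \<eta> \<Theta> \<theta>0 x \<omega>)\<^sup>2 \<partial>\<xi>)"
  by (cases \<omega>) (simp add: H_E_def response_quotient_def L2_norm_def power_divide)

lemma Psi_eE_eq:
  "Psi_eE \<eta> \<Theta> \<theta>0 x \<omega> \<xi> = (response_quotient \<eta> \<Theta> \<theta>0 x \<omega>)\<^sup>2 - H_E \<eta> \<Theta> \<theta>0 \<xi> \<omega>"
  by (cases \<omega>) (simp add: H_E_def Psi_eE_def response_quotient_def power_divide
      diff_divide_distrib[of "v\<^sup>2" for v])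

theorem theorem3:
  fixes X :: "(real ^ 'd) set"
    and \<Theta> :: "(real ^ 'p) set"
    and \<theta>0 :: "real ^ 'p"
    and \<eta> :: "real ^ 'd \<Rightarrow> real ^ 'p \<Rightarrow> real"
    and \<xi> :: "(real ^ 'd) measure"
  assumes "compact X"
    and "compact \<Theta>"
    and "\<Theta> \<subseteq> closure (interior \<Theta>)"
    and "\<theta>0 \<in> \<Theta>"
    and "\<And>x. x \<in> X \<Longrightarrow> twice_continuously_differentiable_on (\<eta> x) (interior \<Theta>)"
    and "\<And>x. x \<in> X \<Longrightarrow> continuous_on \<Theta> (\<eta> x)"
    and "\<And>x. x \<in> X \<Longrightarrow> \<eta> x differentiable (at \<theta>0 within \<Theta>)"
    and "\<And>\<theta> \<theta>'. \<theta> \<in> \<Theta> \<Longrightarrow> \<theta>' \<in> \<Theta> \<Longrightarrow> (\<forall>x\<in>X. \<eta> x \<theta>' = \<eta> x \<theta>) \<Longrightarrow> \<theta>' = \<theta>"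
    and "\<And>\<nu> \<theta>. \<nu> \<in> prob_measures X \<Longrightarrow> \<theta> \<in> \<Theta> \<Longrightarrow>
           (\<lambda>x. \<eta> x \<theta> - \<eta> x \<theta>0) \<in> L2_space \<nu>"
    and "\<And>\<nu> u. \<nu> \<in> prob_measures X \<Longrightarrow> (\<theta>0, u) \<in> directed_points \<Theta> \<theta>0 \<Longrightarrow>
           directional_response \<eta> \<Theta> \<theta>0 u \<in> L2_space \<nu>"
    and "\<xi> \<in> prob_measures X"
  shows "optimal_design \<eta> X \<Theta> \<theta>0 \<xi> \<longleftrightarrow>
    (\<exists>\<mu> \<in> prob_measures (Theta_E \<eta> \<Theta> \<theta>0 \<xi>).
       (\<forall>x\<in>X. (\<integral>\<omega>. Psi_eE \<eta> \<Theta> \<theta>0 x \<omega> \<xi> \<partial>\<mu>) \<le> 0) \<and>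
       (\<exists>x\<in>X. (\<integral>\<omega>. Psi_eE \<eta> \<Theta> \<theta>0 x \<omega> \<xi> \<partial>\<mu>) = 0))"
proof -
  note \<Theta> = assms(2) and resp_L2 = assms(9,10) and \<xi> = assms(11)
  define K where "K = directed_points \<Theta> \<theta>0"
  define f where "f x \<omega> = (response_quotient \<eta> \<Theta> \<theta>0 x \<omega>)\<^sup>2" for x \<omega>
  interpret design_game X K f
  proof
    show "compact K" "K \<noteq> {}"
      using compact_directed_points[OF \<Theta>] directed_points_nonempty[OF assms(3,4)] by (simp_all add: K_def)
    show "continuous_on K (f x)" if "x \<in> X" for x
      unfolding K_def f_def using compact_imp_closed[OF \<Theta>] assms(6,7)[OF that]
      by (intro continuous_on_power response_quotient_continuous)
    show "integrable \<nu> (\<lambda>x. f x \<omega>)" if "\<nu> \<in> prob_measures X" "\<omega> \<in> K" for \<nu> \<omega>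
    proof -
      obtain \<theta> u where \<omega>: "\<omega> = (\<theta>, u)" by fastforce
      show ?thesis
      proof (cases "\<theta> = \<theta>0")
        case True
        then show ?thesis
          using resp_L2(2)[OF that(1), of u] that(2)
          by (simp add: \<omega> K_def f_def response_quotient_def L2_space_def)
      next
        case False
        then have "\<theta> \<in> \<Theta>"
          using that(2) directed_points_subset[OF compact_imp_closed[OF \<Theta>]] by (auto simp: \<omega> K_def)
        then show ?thesis
          using resp_L2(1)[OF that(1), of \<theta>] False
          by (simp add: \<omega> f_def response_quotient_def L2_space_def power_divide)
      qed
    qed
  qed (simp add: f_def)
  have H: "H_E \<eta> \<Theta> \<theta>0 \<nu> = payoff \<nu>" for \<nu>
    by (simp add: fun_eq_iff H_E_eq_integral payoff_def f_def)
  have phi: "phi_eE \<eta> \<Theta> \<theta>0 \<nu> = worst_case \<nu>" for \<nu>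
    unfolding phi_eE_def H worst_case_def K_def[symmetric] ..
  have argmin: "Theta_E \<eta> \<Theta> \<theta>0 \<xi> = minimisers \<xi>"
    unfolding Theta_E_def H phi minimisers_def K_def[symmetric] ..
  have Psi: "(\<integral>\<omega>. Psi_eE \<eta> \<Theta> \<theta>0 x \<omega> \<xi> \<partial>\<mu>) = (\<integral>\<omega>. f x \<omega> \<partial>\<mu>) - worst_case \<xi>"
    if \<mu>: "\<mu> \<in> prob_measures (minimisers \<xi>)" and "x \<in> X" for \<mu> x
  proof -
    interpret prob_space \<mu> using \<mu> by (rule prob_measuresD)
    have sub: "minimisers \<xi> \<subseteq> K" by (auto simp: minimisers_def)
    have "(\<integral>\<omega>. Psi_eE \<eta> \<Theta> \<theta>0 x \<omega> \<xi> \<partial>\<mu>) = (\<integral>\<omega>. f x \<omega> - worst_case \<xi> \<partial>\<mu>)"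
      using prob_measuresD(3)[OF \<mu>]
      by (intro Bochner_Integration.integral_cong) (auto simp: Psi_eE_eq f_def H minimisers_def)
    also have "\<dots> = (\<integral>\<omega>. f x \<omega> \<partial>\<mu>) - worst_case \<xi>"
      using continuous_integrable_prob_measures[OF \<mu> K(1) sub cont[OF \<open>x \<in> X\<close>]]
      by (simp add: prob_space)
    finally show ?thesis .
  qed
  have "optimal_design \<eta> X \<Theta> \<theta>0 \<xi> \<longleftrightarrow> (\<forall>\<nu>\<in>prob_measures X. worst_case \<nu> \<le> worst_case \<xi>)"
    using \<xi> by (simp add: optimal_design_def phi)
  also have "\<dots> \<longleftrightarrow> (\<exists>\<mu>\<in>prob_measures (minimisers \<xi>).
      (\<forall>x\<in>X. (\<integral>\<omega>. f x \<omega> \<partial>\<mu>) \<le> worst_case \<xi>) \<and> (\<exists>x\<in>X. (\<integral>\<omega>. f x \<omega> \<partial>\<mu>) = worst_case \<xi>))"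
    by (rule optimal_design_iff_dual_measure[OF \<xi>])
  also have "\<dots> \<longleftrightarrow> (\<exists>\<mu>\<in>prob_measures (minimisers \<xi>).
      (\<forall>x\<in>X. (\<integral>\<omega>. Psi_eE \<eta> \<Theta> \<theta>0 x \<omega> \<xi> \<partial>\<mu>) \<le> 0) \<and>
      (\<exists>x\<in>X. (\<integral>\<omega>. Psi_eE \<eta> \<Theta> \<theta>0 x \<omega> \<xi> \<partial>\<mu>) = 0))"
    by (intro bex_cong ball_cong conj_cong refl) (simp_all add: Psi)
  finally show ?thesis
    unfolding argmin .
qed

end
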